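(* The root problem is solvable for Garside groups. That is, for every Garside group $G$ there is an algorithm which, given an element $g\in G$ and an integer $n\geqslant 2$, decides whether the equation $x^n=g$ has a solution $x\in G$ and, if so, finds a solution.
   Context: Garside monoids and groups. Let $M$ be a monoid. An atom of $M$ is an element $a\neq 1$ such that $a=bc$ with $b,c\in M$ implies $b=1$ or $c=1$. For $a\in M$ let $\|a\|$ be the supremum of the lengths of all expressions of $a$ as a product of atoms. $M$ is atomic if it is generated by its atoms and $\|a\|<\infty$ for all $a\in M$. In an atomic monoid: $a\leqslant_L b$ if $ac=b$ for some $c\in M$, and $a\leqslant_R b$ if $ca=b$ for some $c\in M$; $L(a)=\{b: b\leqslant_L a\}$, $R(a)=\{b: b\leqslant_R a\}$. An atomic monoid $M$ is a Garside monoid if it is finitely generated, left and right cancellative, $(M,\leqslant_L)$ and $(M,\leqslant_R)$ are lattices, and there is an element $\Delta\in M$ (a Garside element) such that $L(\Delta)=R(\Delta)$ and this set generates $M$. A Garside monoid embeds in its group of fractions; a Garside group is the group of fractions of a Garside monoid. The root problem in a group $G$ is to solve the equation $x^n=g$ in $G$ for $x$, given $g\in G$ and $n\geqslant 2$. Elements of $G$ are given as words in a fixed finite generating set (for example the atoms of the Garside monoid and their inverses). *)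

theory Defs
  imports
    "HOL-Algebra.Divisibility"
    "HOL-Algebra.Generated_Groups"
    "HOL-Library.Extended_Nat"
    "HOL-Library.Nat_Bijection"
begin

section \<open>Garside monoids and Garside groups\<close>

definition list_prod :: "('a, 'm) monoid_scheme \<Rightarrow> 'a list \<Rightarrow> 'a" where
  "list_prod M xs = foldr (\<otimes>\<^bsub>M\<^esub>) xs \<one>\<^bsub>M\<^esub>"

definition monoid_generated_by :: "('a, 'm) monoid_scheme \<Rightarrow> 'a set \<Rightarrow> bool" where
  "monoid_generated_by M S \<longleftrightarrow>
     S \<subseteq> carrier M \<and> (\<forall>a \<in> carrier M. \<exists>xs. set xs \<subseteq> S \<and> list_prod M xs = a)"

definition atoms :: "('a, 'm) monoid_scheme \<Rightarrow> 'a set" where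
  "atoms M = {a \<in> carrier M. a \<noteq> \<one>\<^bsub>M\<^esub> \<and>
     (\<forall>b \<in> carrier M. \<forall>c \<in> carrier M. a = b \<otimes>\<^bsub>M\<^esub> c \<longrightarrow> b = \<one>\<^bsub>M\<^esub> \<or> c = \<one>\<^bsub>M\<^esub>)}"

definition atom_norm :: "('a, 'm) monoid_scheme \<Rightarrow> 'a \<Rightarrow> enat" where
  "atom_norm M a = (SUP xs \<in> {xs. set xs \<subseteq> atoms M \<and> list_prod M xs = a}. enat (length xs))"

definition atomic_monoid :: "('a, 'm) monoid_scheme \<Rightarrow> bool" where
  "atomic_monoid M \<longleftrightarrow>
     monoid M \<and> monoid_generated_by M (atoms M) \<and> (\<forall>a \<in> carrier M. atom_norm M a < \<infinity>)"

definition le_L :: "('a, 'm) monoid_scheme \<Rightarrow> 'a \<Rightarrow> 'a \<Rightarrow> bool" where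
  "le_L M a b \<longleftrightarrow> (\<exists>c \<in> carrier M. a \<otimes>\<^bsub>M\<^esub> c = b)"

definition le_R :: "('a, 'm) monoid_scheme \<Rightarrow> 'a \<Rightarrow> 'a \<Rightarrow> bool" where
  "le_R M a b \<longleftrightarrow> (\<exists>c \<in> carrier M. c \<otimes>\<^bsub>M\<^esub> a = b)"

definition L_set :: "('a, 'm) monoid_scheme \<Rightarrow> 'a \<Rightarrow> 'a set" where
  "L_set M a = {b \<in> carrier M. le_L M b a}"

definition R_set :: "('a, 'm) monoid_scheme \<Rightarrow> 'a \<Rightarrow> 'a set" where
  "R_set M a = {b \<in> carrier M. le_R M b a}"

definition garside_element :: "('a, 'm) monoid_scheme \<Rightarrow> 'a \<Rightarrow> bool" where
  "garside_element M \<Delta> \<longleftrightarrow>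
     \<Delta> \<in> carrier M \<and> L_set M \<Delta> = R_set M \<Delta> \<and> monoid_generated_by M (L_set M \<Delta>)"

definition garside_monoid :: "('a, 'm) monoid_scheme \<Rightarrow> bool" where
  "garside_monoid M \<longleftrightarrow>
     atomic_monoid M \<and>
     (\<exists>S. finite S \<and> monoid_generated_by M S) \<and>
     monoid_cancel M \<and>
     Lattice.lattice \<lparr>carrier = carrier M, eq = (=), le = le_L M\<rparr> \<and>
     Lattice.lattice \<lparr>carrier = carrier M, eq = (=), le = le_R M\<rparr> \<and>
     (\<exists>\<Delta>. garside_element M \<Delta>)"

text \<open>
  The group of fractions is only determined up to isomorphism, so it is given together with
  the embedding of the monoid. An element of \<^term>\<open>mon M G\<close> preserves the unit because
  \<^term>\<open>G\<close> is a group.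
\<close>

definition group_of_fractions ::
    "('a, 'm) monoid_scheme \<Rightarrow> ('b, 'g) monoid_scheme \<Rightarrow> ('a \<Rightarrow> 'b) \<Rightarrow> bool" where
  "group_of_fractions M G \<iota> \<longleftrightarrow>
     group G \<and> \<iota> \<in> mon M G \<and>
     (\<forall>g \<in> carrier G. \<exists>a \<in> carrier M. \<exists>b \<in> carrier M. g = \<iota> a \<otimes>\<^bsub>G\<^esub> inv\<^bsub>G\<^esub> (\<iota> b))"

section \<open>Partial recursive functions\<close>

datatype recf =
    Zero
  | Succ
  | Proj nat
  | Comp recf "recf list"
  | PrimRec recf recf
  | Mu recf

text \<open>
  \<^term>\<open>rec_eval p xs y\<close> means that the partial recursive function denoted by \<^term>\<open>p\<close> is
  defined at \<^term>\<open>xs\<close> with value \<^term>\<open>y\<close>. The recursion and minimisation variable is the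
  first argument; minimisation requires all smaller arguments to yield defined, nonzero values.
\<close>

inductive rec_eval :: "recf \<Rightarrow> nat list \<Rightarrow> nat \<Rightarrow> bool" where
  zero: "rec_eval Zero xs 0"
| succ: "rec_eval Succ [x] (Suc x)"
| proj: "i < length xs \<Longrightarrow> rec_eval (Proj i) xs (xs ! i)"
| comp: "length ys = length gs \<Longrightarrow> (\<forall>i < length gs. rec_eval (gs ! i) xs (ys ! i)) \<Longrightarrow>
         rec_eval f ys z \<Longrightarrow> rec_eval (Comp f gs) xs z"
| primrec_0: "rec_eval f xs y \<Longrightarrow> rec_eval (PrimRec f g) (0 # xs) y"
| primrec_Suc: "rec_eval (PrimRec f g) (n # xs) y \<Longrightarrow> rec_eval g (n # y # xs) z \<Longrightarrow>
         rec_eval (PrimRec f g) (Suc n # xs) z"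
| mu: "rec_eval f (n # xs) 0 \<Longrightarrow> (\<forall>m < n. \<exists>y. rec_eval f (m # xs) (Suc y)) \<Longrightarrow>
         rec_eval (Mu f) xs n"

lemma rec_eval_deterministic:
  "rec_eval p xs y \<Longrightarrow> rec_eval p xs z \<Longrightarrow> y = z"
proof (induction arbitrary: z rule: rec_eval.induct)
  case (zero xs)
  then show ?case by (auto elim: rec_eval.cases)
next
  case (succ x)
  then show ?case by (auto elim: rec_eval.cases)
next
  case (proj i xs)
  from proj.prems show ?case by cases auto
next
  case (comp ys gs xs f w)
  from comp.prems obtain ys' where ys': "length ys' = length gs"
      "\<forall>i < length gs. rec_eval (gs ! i) xs (ys' ! i)" "rec_eval f ys' z"
    by cases auto
  have "ys = ys'"
    using comp.hyps comp.IH(1) ys' by (intro nth_equalityI) auto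
  then show ?case
    using comp.IH(2) ys'(3) by blast
next
  case (primrec_0 f xs y g)
  from primrec_0.prems primrec_0.IH show ?case by cases auto
next
  case (primrec_Suc f g n xs y w)
  from primrec_Suc.prems primrec_Suc.IH show ?case by cases auto
next
  case (mu f n xs)
  from mu.prems show ?case
  proof cases
    case (mu)
    note z = this
    have "\<not> z < n"
    proof
      assume "z < n"
      then obtain y where "\<forall>v. rec_eval f (z # xs) v \<longrightarrow> Suc y = v"
        using mu.IH(2) by blast
      with z(1) show False by blast
    qed
    moreover have "\<not> n < z"
    proof
      assume "n < z"
      then obtain y where "rec_eval f (n # xs) (Suc y)" using z(2) by blast
      with mu.IH(1) show False by blast
    qed
    ultimately show "n = z" by simp
  qed
qed

section \<open>The root problem\<close>

text \<open>
  A word over the generators \<^term>\<open>gs\<close> and their inverses is a list of letters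
  \<^term>\<open>(i, b)\<close>, standing for the \<^term>\<open>i\<close>-th generator if \<^term>\<open>b\<close> is false and for its
  inverse if \<^term>\<open>b\<close> is true.
\<close>

type_synonym gword = "(nat \<times> bool) list"

definition valid_word :: "'b list \<Rightarrow> gword \<Rightarrow> bool" where
  "valid_word gs w \<longleftrightarrow> (\<forall>(i, b) \<in> set w. i < length gs)"

definition letter_val :: "('b, 'g) monoid_scheme \<Rightarrow> 'b list \<Rightarrow> nat \<times> bool \<Rightarrow> 'b" where
  "letter_val G gs l = (if snd l then inv\<^bsub>G\<^esub> (gs ! fst l) else gs ! fst l)"

definition word_val :: "('b, 'g) monoid_scheme \<Rightarrow> 'b list \<Rightarrow> gword \<Rightarrow> 'b" where
  "word_val G gs w = list_prod G (map (letter_val G gs) w)"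

definition word_code :: "gword \<Rightarrow> nat" where
  "word_code w = list_encode (map (\<lambda>(i, b). 2 * i + of_bool b) w)"

text \<open>
  One program takes the code of a word for \<open>g\<close> and the exponent \<open>n\<close>. Its output is 0 if \<open>g\<close>
  has no \<open>n\<close>-th root, and otherwise one more than the code of a word representing such a root.
\<close>

definition root_problem_solvable :: "('b, 'g) monoid_scheme \<Rightarrow> 'b list \<Rightarrow> bool" where
  "root_problem_solvable G gs \<longleftrightarrow>
     (\<exists>p. \<forall>w n. valid_word gs w \<and> n \<ge> 2 \<longrightarrow>
        (if \<exists>x \<in> carrier G. x [^]\<^bsub>G\<^esub> n = word_val G gs w
         then \<exists>v. valid_word gs v \<and> word_val G gs v [^]\<^bsub>G\<^esub> n = word_val G gs w \<and>
                  rec_eval p [word_code w, n] (Suc (word_code v))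
         else rec_eval p [word_code w, n] 0))"

end

theory Submission
  imports Defs
begin

text \<open>
  Order the group \<open>G\<close> by \<open>a \<le> b\<close> iff \<open>a\<^sup>-\<^sup>1 b\<close> is the image of an element of the monoid. Joins exist in \<open>G\<close>,
  and a power of the Garside element is central; let \<open>F\<close> be a large power of it, so that \<open>F g\<close> is
  positive for every generator \<open>g\<close> and its inverse, and call the finitely many elements of
  \<open>[1, F\<^sup>2]\<close> simple. After multiplication by a power of \<open>F\<close>, a root \<open>x\<close> of \<open>g\<close> satisfies
  \<open>x\<^sup>n \<in> [1, F\<^sup>m]\<close> with known \<open>m\<close>. Conjugating by the join of \<open>1, x\<^sup>-\<^sup>1, \<dots>, x\<^sup>1\<^sup>-\<^sup>n\<close> moves \<open>x\<close> itself into
  \<open>[1, F\<^sup>m]\<close>, and two conjugate elements of an interval \<open>[1, F\<^sup>k]\<close> are connected inside it by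
  conjugations with simple elements. The number of conjugations needed is at most the number of
  pairs in that finite interval, so if a root exists then there is one whose word length is bounded
  by a computable function of the word for \<open>g\<close> and \<open>n\<close>. Candidates are tested with the word problem,
  which a transducer on words of simple elements decides by successive left division.
\<close>

section \<open>Computable functions\<close>

text \<open>Arguments are kept as one list, so functions of every arity share one notion;
  \<open>f\<close> is constrained only on lists of length \<open>k\<close>.\<close>

definition computable :: "nat \<Rightarrow> (nat list \<Rightarrow> nat) \<Rightarrow> bool" where
  "computable k f \<longleftrightarrow> (\<exists>p. \<forall>xs. length xs = k \<longrightarrow> rec_eval p xs (f xs))"

abbreviation computable1 :: "(nat \<Rightarrow> nat) \<Rightarrow> bool" where
  "computable1 f \<equiv> computable 1 (\<lambda>xs. f (xs ! 0))"

abbreviation computable2 :: "(nat \<Rightarrow> nat \<Rightarrow> nat) \<Rightarrow> bool" where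
  "computable2 f \<equiv> computable 2 (\<lambda>xs. f (xs ! 0) (xs ! 1))"

abbreviation computable3 :: "(nat \<Rightarrow> nat \<Rightarrow> nat \<Rightarrow> nat) \<Rightarrow> bool" where
  "computable3 f \<equiv> computable 3 (\<lambda>xs. f (xs ! 0) (xs ! 1) (xs ! 2))"

lemma computable_cong:
  assumes "computable k f" "\<And>xs. length xs = k \<Longrightarrow> f xs = g xs"
  shows "computable k g"
  using assms unfolding computable_def by metis

lemma computable_comp:
  assumes "computable (length gs) f" "\<And>g. g \<in> set gs \<Longrightarrow> computable k g"
  shows "computable k (\<lambda>xs. f (map (\<lambda>g. g xs) gs))"
proof -
  obtain p where p: "\<And>xs. length xs = length gs \<Longrightarrow> rec_eval p xs (f xs)"
    using assms(1) unfolding computable_def by blast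
  have "\<forall>g\<in>set gs. \<exists>q. \<forall>xs. length xs = k \<longrightarrow> rec_eval q xs (g xs)"
    using assms(2) unfolding computable_def by blast
  then obtain q where q: "\<And>g xs. g \<in> set gs \<Longrightarrow> length xs = k \<Longrightarrow> rec_eval (q g) xs (g xs)"
    by metis
  show ?thesis
    unfolding computable_def
  proof (intro exI[of _ "Comp p (map q gs)"] allI impI)
    fix xs :: "nat list"
    assume "length xs = k"
    then show "rec_eval (Comp p (map q gs)) xs (f (map (\<lambda>g. g xs) gs))"
      by (intro rec_eval.comp[of "map (\<lambda>g. g xs) gs"]) (auto simp: p q)
  qed
qed

lemma computable_app1:
  assumes "computable1 f" "computable k g"
  shows "computable k (\<lambda>xs. f (g xs))"
  using computable_comp[of "[g]" "\<lambda>xs. f (xs ! 0)" k] assms by simp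

lemma computable_app2:
  assumes "computable2 f" "computable k g" "computable k h"
  shows "computable k (\<lambda>xs. f (g xs) (h xs))"
  using computable_comp[of "[g, h]" "\<lambda>xs. f (xs ! 0) (xs ! 1)" k] assms
  by (auto simp: numeral_2_eq_2)

lemma computable_app3:
  assumes "computable3 f" "computable k g" "computable k h" "computable k i"
  shows "computable k (\<lambda>xs. f (g xs) (h xs) (i xs))"
  using computable_comp[of "[g, h, i]" "\<lambda>xs. f (xs ! 0) (xs ! 1) (xs ! 2)" k] assms
  by (auto simp: numeral_3_eq_3 numeral_2_eq_2)

lemma computable_nth: "i < k \<Longrightarrow> computable k (\<lambda>xs. xs ! i)"
  unfolding computable_def by (auto intro!: exI[of _ "Proj i"] rec_eval.proj)

lemma computable_Suc:
  assumes "computable k f"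
  shows "computable k (\<lambda>xs. Suc (f xs))"
proof (rule computable_app1[OF _ assms])
  show "computable1 Suc"
    unfolding computable_def
    by (auto intro!: exI[of _ Succ] simp: length_Suc_conv rec_eval.succ)
qed

lemma computable_const: "computable k (\<lambda>xs. c)"
proof (induction c)
  case 0
  show ?case unfolding computable_def by (auto intro!: exI[of _ Zero] rec_eval.zero)
qed (rule computable_Suc)

lemma computable_primrec:
  assumes "computable k a" "computable (Suc (Suc k)) s"
  shows "computable (Suc k) (\<lambda>xs. rec_nat (a (tl xs)) (\<lambda>i acc. s (i # acc # tl xs)) (hd xs))"
proof -
  obtain p where p: "\<And>xs. length xs = k \<Longrightarrow> rec_eval p xs (a xs)"
    using assms(1) unfolding computable_def by blast
  obtain q where q: "\<And>xs. length xs = Suc (Suc k) \<Longrightarrow> rec_eval q xs (s xs)"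
    using assms(2) unfolding computable_def by blast
  have "rec_eval (PrimRec p q) (n # xs) (rec_nat (a xs) (\<lambda>i acc. s (i # acc # xs)) n)"
    if "length xs = k" for n xs
  proof (induction n)
    case 0
    then show ?case
      using rec_eval.primrec_0[OF p[OF that]] by simp
  next
    case (Suc n)
    then show ?case
      using rec_eval.primrec_Suc[OF Suc q] that by simp
  qed
  then have "rec_eval (PrimRec p q) xs (rec_nat (a (tl xs)) (\<lambda>i acc. s (i # acc # tl xs)) (hd xs))"
    if "length xs = Suc k" for xs
    using that by (cases xs) auto
  then show ?thesis
    unfolding computable_def by blast
qed

text \<open>The second assumption makes the search total; below the least zero the values of
  \<open>f\<close> are defined and nonzero, as \<open>Mu\<close> demands.\<close>

lemma computable2_mu:
  assumes "computable3 f" "\<And>x y. \<exists>n. f n x y = 0"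
  shows "computable2 (\<lambda>x y. LEAST n. f n x y = 0)"
proof -
  obtain p where p: "\<And>xs. length xs = 3 \<Longrightarrow> rec_eval p xs (f (xs ! 0) (xs ! 1) (xs ! 2))"
    using assms(1) unfolding computable_def by blast
  have p': "rec_eval p [n, x, y] (f n x y)" for n x y
    using p[of "[n, x, y]"] by simp
  have "rec_eval (Mu p) [x, y] (LEAST n. f n x y = 0)" for x y
  proof (rule rec_eval.mu)
    have "f (LEAST n. f n x y = 0) x y = 0"
      using LeastI_ex[OF assms(2)] .
    then show "rec_eval p [LEAST n. f n x y = 0, x, y] 0"
      using p' by metis
    show "\<forall>m<LEAST n. f n x y = 0. \<exists>z. rec_eval p [m, x, y] (Suc z)"
      using p' not_less_Least by (metis not0_implies_Suc)
  qed
  then show ?thesis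
    unfolding computable_def
    by (intro exI[of _ "Mu p"]) (auto simp: numeral_2_eq_2 length_Suc_conv)
qed

text \<open>Primitive recursion that ignores its counter. Arithmetic and the traversal of coded
  lists are both obtained as iterations of a step with one fixed parameter.\<close>

lemma computable3_funpow:
  assumes "computable2 s"
  shows "computable3 (\<lambda>n v a. (s v ^^ n) a)"
proof -
  have "(s v ^^ n) a = rec_nat a (\<lambda>_. s v) n" for n v a
    by (induction n) auto
  moreover have "computable (Suc 2) (\<lambda>xs. rec_nat (tl xs ! 1)
      (\<lambda>i acc. s ((i # acc # tl xs) ! 2) ((i # acc # tl xs) ! 1)) (hd xs))"
    by (rule computable_primrec)
      (simp_all, (intro computable_app2[OF assms] computable_nth; simp)+)
  ultimately have "computable (Suc 2) (\<lambda>xs. (s (xs ! 1) ^^ (xs ! 0)) (xs ! 2))"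
    by (elim computable_cong) (auto simp: length_Suc_conv numeral_2_eq_2)
  then show ?thesis
    by (simp add: numeral_3_eq_3)
qed

lemma computable_funpow:
  assumes "computable2 s" "computable k n" "computable k v" "computable k a"
  shows "computable k (\<lambda>xs. (s (v xs) ^^ n xs) (a xs))"
  by (rule computable_app3[OF computable3_funpow[OF assms(1)] assms(2-4)])

lemma computable1_rec:
  assumes "computable2 s"
  shows "computable1 (rec_nat c s)"
proof -
  have "computable (Suc 0) (\<lambda>xs. rec_nat c
      (\<lambda>i acc. s ((i # acc # tl xs) ! 0) ((i # acc # tl xs) ! 1)) (hd xs))"
    by (rule computable_primrec[OF computable_const])
      (use assms in \<open>simp add: numeral_2_eq_2\<close>)
  then show ?thesis
    by (auto elim!: computable_cong simp: length_Suc_conv)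
qed

lemma computable_add:
  assumes "computable k f" "computable k g"
  shows "computable k (\<lambda>xs. f xs + g xs)"
proof -
  have "(Suc ^^ n) m = n + m" for n m :: nat
    by (induction n) auto
  moreover have "computable k (\<lambda>xs. (Suc ^^ f xs) (g xs))"
    by (rule computable_funpow[of "\<lambda>_. Suc", OF _ assms(1) computable_const assms(2)])
      (intro computable_Suc computable_nth; simp)
  ultimately show ?thesis by simp
qed

lemma computable_mult:
  assumes "computable k f" "computable k g"
  shows "computable k (\<lambda>xs. f xs * g xs)"
proof -
  have "((+) m ^^ n) 0 = n * m" for n m :: nat
    by (induction n) auto
  moreover have "computable k (\<lambda>xs. ((+) (g xs) ^^ f xs) 0)"
    by (rule computable_funpow) (intro computable_add computable_nth computable_const assms; simp)+
  ultimately show ?thesis by simp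
qed

lemma computable_power:
  assumes "computable k f" "computable k g"
  shows "computable k (\<lambda>xs. f xs ^ g xs)"
proof -
  have "((*) m ^^ n) 1 = m ^ n" for n m :: nat
    by (induction n) auto
  moreover have "computable k (\<lambda>xs. ((*) (f xs) ^^ g xs) 1)"
    by (rule computable_funpow) (intro computable_mult computable_nth computable_const assms; simp)+
  ultimately show ?thesis by simp
qed

lemma computable_diff:
  assumes "computable k f" "computable k g"
  shows "computable k (\<lambda>xs. f xs - g xs)"
proof -
  have "rec_nat 0 (\<lambda>i _. i) n = n - 1" for n :: nat
    by (cases n) auto
  then have pred: "computable1 (\<lambda>n. n - 1)"
    using computable1_rec[of "\<lambda>i _. i" 0] computable_nth[of 0 2] by simp
  have "((\<lambda>n. n - 1) ^^ n) m = m - n" for n m :: nat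
    by (induction n) auto
  moreover have "computable k (\<lambda>xs. ((\<lambda>n. n - 1) ^^ g xs) (f xs))"
    by (rule computable_funpow[of "\<lambda>_ n. n - 1" k g "\<lambda>_. 0" f])
      (intro computable_app1[OF pred] computable_nth computable_const assms; simp)+
  ultimately show ?thesis by simp
qed

lemmas computable_intros =
  computable_const computable_nth computable_Suc computable_add computable_mult
  computable_power computable_diff

section \<open>Case distinctions and finite tables\<close>

lemma computable_if_zero:
  assumes "computable k b" "computable k f" "computable k g"
  shows "computable k (\<lambda>xs. if b xs = 0 then f xs else g xs)"
proof -
  \<comment> \<open>With truncated subtraction \<open>1 - b xs\<close> is the indicator of
    \<open>b xs = 0\<close>, and \<open>1 - (1 - b xs)\<close> that of its negation.\<close>
  have "computable k (\<lambda>xs. (1 - b xs) * f xs + (1 - (1 - b xs)) * g xs)"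
    by (intro computable_intros assms)
  then show ?thesis
    by (rule computable_cong) auto
qed

lemma computable_if_eq_const:
  assumes "computable k b" "computable k f" "computable k g"
  shows "computable k (\<lambda>xs. if b xs = c then f xs else g xs)"
proof -
  have "computable k (\<lambda>xs. if (b xs - c) + (c - b xs) = 0 then f xs else g xs)"
    by (intro computable_intros computable_if_zero assms)
  then show ?thesis
    by (rule computable_cong) auto
qed

lemma computable_table:
  assumes "computable k b" "\<And>x. x < N \<Longrightarrow> computable k (\<lambda>xs. f x xs)" "computable k g"
  shows "computable k (\<lambda>xs. if b xs < N then f (b xs) xs else g xs)"
  using assms(2)
proof (induction N)
  case (Suc N)
  then have "computable k (\<lambda>xs. if b xs = N then f N xs else if b xs < N then f (b xs) xs else g xs)"
    using assms(1) by (intro computable_if_eq_const) auto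
  then show ?case
    by (rule computable_cong) (auto simp: less_Suc_eq)
qed (use assms(3) in simp)

text \<open>A finite table is a program whatever the origin of its entries. In this way operations
  on the finite set of simple elements, defined by choice, become computable.\<close>

lemma computable1_eventually_const:
  assumes "\<And>x. x \<ge> N \<Longrightarrow> f x = f N"
  shows "computable1 f"
proof -
  have "computable1 (\<lambda>x. if x < N then f x else f N)"
    by (rule computable_table) (intro computable_intros; simp)+
  then show ?thesis
    by (rule computable_cong) (metis assms not_less)
qed

lemma computable2_eventually_const:
  assumes "\<And>x y. x \<ge> N \<Longrightarrow> f x y = f N y" "\<And>x y. y \<ge> N \<Longrightarrow> f x y = f x N"
  shows "computable2 f"
proof -
  have row: "computable 2 (\<lambda>xs. f x (xs ! 1))" for x
    by (rule computable_app1[of "f x"], rule computable1_eventually_const[of N], rule assms(2))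
      (simp_all add: computable_nth)
  have "computable2 (\<lambda>x y. if x < N then f x y else f N y)"
    by (rule computable_table[OF _ row row]) (simp add: computable_nth)
  then show ?thesis
    by (rule computable_cong) (metis assms(1) not_less)
qed

section \<open>Pairs and lists coded as numbers\<close>

lemma computable_prod_encode:
  assumes "computable k f" "computable k g"
  shows "computable k (\<lambda>xs. prod_encode (f xs, g xs))"
proof -
  have "rec_nat 0 (\<lambda>i a. a + Suc i) n = triangle n" for n
    by (induction n) auto
  then have tri: "computable1 triangle"
    using computable1_rec[of "\<lambda>i a. a + Suc i" 0]
      computable_add[OF computable_nth computable_Suc[OF computable_nth], of 1 2 0] by simp
  have "computable k (\<lambda>xs. triangle (f xs + g xs) + f xs)"
    by (intro computable_app1[OF tri] computable_intros assms)
  then show ?thesis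
    by (simp add: prod_encode_def)
qed

definition pfst :: "nat \<Rightarrow> nat" where "pfst z = fst (prod_decode z)"
definition psnd :: "nat \<Rightarrow> nat" where "psnd z = snd (prod_decode z)"

lemma pfst_prod_encode [simp]: "pfst (prod_encode (a, b)) = a"
  and psnd_prod_encode [simp]: "psnd (prod_encode (a, b)) = b"
  by (simp_all add: pfst_def psnd_def)

lemma triangle_mono: "m \<le> n \<Longrightarrow> triangle m \<le> triangle n"
  unfolding triangle_def by (intro div_le_mono mult_le_mono) auto

text \<open>A code \<open>z\<close> of \<open>(a, b)\<close> satisfies
  \<open>triangle (a + b) <= z < triangle (a + b + 1)\<close>. Hence \<open>a + b\<close> is found
  by minimisation, and \<open>a\<close> and \<open>b\<close> follow by subtraction.\<close>

lemma computable1_pfst_psnd: "computable1 pfst \<and> computable1 psnd"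
proof -
  define t where "t z = (LEAST t. Suc z - triangle (Suc t) = 0)" for z
  have t: "t (prod_encode (a, b)) = a + b" for a b
    unfolding t_def
  proof (rule Least_equality)
    fix y assume y: "Suc (prod_encode (a, b)) - triangle (Suc y) = 0"
    show "a + b \<le> y"
    proof (rule ccontr)
      assume "\<not> a + b \<le> y"
      then have "triangle (Suc y) \<le> triangle (a + b)"
        by (intro triangle_mono) auto
      then show False
        using y by (auto simp: prod_encode_def)
    qed
  qed (auto simp: prod_encode_def)
  have ex: "\<exists>n. Suc z - triangle (Suc n) = 0" for z
    by (intro exI[of _ z]) auto
  have tri: "computable1 triangle"
  proof -
    have "computable1 (\<lambda>n. prod_encode (0, n))"
      by (intro computable_prod_encode computable_intros) simp
    then show ?thesis by (simp add: prod_encode_def)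
  qed
  have "computable2 (\<lambda>z _. t z)"
    unfolding t_def
    by (rule computable2_mu[of "\<lambda>n x y. Suc x - triangle (Suc n)"])
      (intro computable_intros computable_app1[OF tri] ex; simp)+
  then have t1: "computable 1 (\<lambda>xs. t (xs ! 0))"
    using computable_app2[of "\<lambda>z _. t z" 1 "\<lambda>xs. xs ! 0" "\<lambda>_. 0"]
    by (simp add: computable_nth computable_const)
  have t2: "computable 1 (\<lambda>xs. triangle (t (xs ! 0)))"
    by (rule computable_app1[OF tri t1])
  have "pfst z = z - triangle (t z) \<and> psnd z = t z - (z - triangle (t z))" for z
  proof -
    obtain a b where "z = prod_encode (a, b)"
      by (metis prod_decode_inverse surj_pair)
    then show ?thesis
      by (simp add: t) (simp add: prod_encode_def)
  qed
  then show ?thesis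
    by (simp only:) (intro conjI computable_intros t1 t2; simp)
qed

lemma computable_pfst: "computable k f \<Longrightarrow> computable k (\<lambda>xs. pfst (f xs))"
  and computable_psnd: "computable k f \<Longrightarrow> computable k (\<lambda>xs. psnd (f xs))"
  using computable1_pfst_psnd by (auto intro: computable_app1)

text \<open>This is \<open>list_encode\<close> of a nonempty list, in terms of the head and the code
  of the tail.\<close>

definition ccons :: "nat \<Rightarrow> nat \<Rightarrow> nat" where
  "ccons x c = Suc (prod_encode (x, c))"

lemma list_decode_ccons [simp]: "list_decode (ccons x c) = x # list_decode c"
  by (simp add: ccons_def)

lemma computable_ccons:
  "computable k f \<Longrightarrow> computable k g \<Longrightarrow> computable k (\<lambda>xs. ccons (f xs) (g xs))"
  unfolding ccons_def by (intro computable_Suc computable_prod_encode)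

text \<open>Allows the code of a list to serve as the iteration count of a loop over that
  list.\<close>

lemma length_list_decode_le: "length (list_decode c) \<le> c"
proof -
  have "length xs \<le> list_encode xs" for xs
  proof (induction xs)
    case (Cons x xs)
    then show ?case
      using le_prod_encode_2[of "list_encode xs" x] by simp
  qed simp
  from this[of "list_decode c"] show ?thesis by simp
qed

definition cfold :: "(nat \<Rightarrow> nat \<Rightarrow> nat) \<Rightarrow> nat \<Rightarrow> nat \<Rightarrow> nat" where
  "cfold f a c = foldl f a (list_decode c)"

lemma computable_cfold:
  assumes "computable2 f" "computable k a" "computable k c"
  shows "computable k (\<lambda>xs. cfold f (a xs) (c xs))"
proof -
  \<comment> \<open>The state pairs the accumulator with the unread part of the list.\<close>
  define step where "step z = (if psnd z = 0 then z else
      prod_encode (f (pfst z) (pfst (psnd z - 1)), psnd (psnd z - 1)))" for z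
  \<comment> \<open>The step is idle once the unread part is empty, so any count not below the
    length gives the same result.\<close>
  have "(step ^^ n) (prod_encode (a, list_encode xs)) = prod_encode (foldl f a xs, 0)"
    if "length xs \<le> n" for n a xs
    using that
  proof (induction xs arbitrary: a n)
    case Nil
    show ?case
      by (induction n) (auto simp: step_def)
  next
    case (Cons x xs)
    then obtain m where "n = Suc m" "length xs \<le> m"
      by (cases n) auto
    then show ?case
      using Cons.IH[of m] by (simp add: funpow_swap1 step_def del: funpow.simps)
        (simp add: funpow_Suc_right step_def del: funpow.simps)
  qed
  from this[of "list_decode c" c a for c a]
  have *: "cfold f a c = pfst ((step ^^ c) (prod_encode (a, c)))" for a c
    by (simp add: cfold_def length_list_decode_le)
  have "computable 2 (\<lambda>xs. step (xs ! 1))"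
    unfolding step_def
    by (intro computable_intros computable_if_zero computable_prod_encode computable_pfst
        computable_psnd computable_app2[OF assms(1)]; simp)
  then have "computable k (\<lambda>xs. (step ^^ c xs) (prod_encode (a xs, c xs)))"
    by (rule computable_funpow[of "\<lambda>_. step" k c "\<lambda>_. 0"])
      (intro computable_prod_encode computable_const assms)+
  then show ?thesis
    unfolding * by (rule computable_pfst)
qed

section \<open>Groups with a lattice-ordered positive cone\<close>

lemma list_prod_Nil [simp]: "list_prod G [] = \<one>\<^bsub>G\<^esub>"
  and list_prod_Cons [simp]: "list_prod G (x # xs) = x \<otimes>\<^bsub>G\<^esub> list_prod G xs"
  by (simp_all add: list_prod_def)

lemma (in monoid) list_prod_closed [simp]:
  "set xs \<subseteq> carrier G \<Longrightarrow> list_prod G xs \<in> carrier G"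
  by (induction xs) auto

lemma (in monoid) list_prod_append:
  "set xs \<subseteq> carrier G \<Longrightarrow> set ys \<subseteq> carrier G \<Longrightarrow>
    list_prod G (xs @ ys) = list_prod G xs \<otimes> list_prod G ys"
  by (induction xs) (auto simp: m_assoc)

context group
begin

lemma inv_mult_cancel [simp]:
  assumes "a \<in> carrier G" "b \<in> carrier G"
  shows "inv a \<otimes> (a \<otimes> b) = b" "a \<otimes> (inv a \<otimes> b) = b"
  using assms by (simp_all flip: m_assoc)

lemma commute_nat_pow:
  assumes "x \<otimes> z = z \<otimes> x" "x \<in> carrier G" "z \<in> carrier G"
  shows "x \<otimes> z [^] (m::nat) = z [^] m \<otimes> x"
proof (induction m)
  case (Suc m)
  have "x \<otimes> z [^] Suc m = z [^] m \<otimes> x \<otimes> z"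
    using assms Suc by (simp flip: m_assoc)
  also have "\<dots> = z [^] Suc m \<otimes> x"
    using assms by (simp add: m_assoc)
  finally show ?case .
qed (use assms in simp)

lemma conj_nat_pow:
  assumes "h \<in> carrier G" "x \<in> carrier G"
  shows "(h \<otimes> x \<otimes> inv h) [^] (n::nat) = h \<otimes> x [^] n \<otimes> inv h"
  using assms by (induction n) (simp_all add: m_assoc)

end

text \<open>\<open>P\<close> models the image of a Garside monoid and \<open>F\<close> a central
  power of its Garside element. Joins are assumed only inside the cone; \<open>ex_shift\<close>
  carries them over to all of \<open>G\<close>. The elements of \<open>[1, F^2]\<close> are the
  simple ones because \<open>F\<close> times a letter will lie there.\<close>

locale central_cone = group G for G (structure) +
  fixes P :: "'a set" and F :: 'a
  assumes P_carrier: "P \<subseteq> carrier G"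
    and one_P [simp]: "\<one> \<in> P"
    and mult_P [simp]: "\<lbrakk>a \<in> P; b \<in> P\<rbrakk> \<Longrightarrow> a \<otimes> b \<in> P"
    and P_pointed: "\<lbrakk>a \<in> P; inv a \<in> P\<rbrakk> \<Longrightarrow> a = \<one>"
    and ex_join_P: "\<lbrakk>a \<in> P; b \<in> P\<rbrakk> \<Longrightarrow> \<exists>j\<in>P. inv a \<otimes> j \<in> P \<and> inv b \<otimes> j \<in> P \<and>
          (\<forall>c\<in>P. inv a \<otimes> c \<in> P \<longrightarrow> inv b \<otimes> c \<in> P \<longrightarrow> inv j \<otimes> c \<in> P)"
    and F_P [simp]: "F \<in> P"
    and F_central: "x \<in> carrier G \<Longrightarrow> x \<otimes> F = F \<otimes> x"
    and ex_shift: "g \<in> carrier G \<Longrightarrow> \<exists>k::nat. F [^] k \<otimes> g \<in> P"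
    and finite_simples: "finite {s \<in> P. inv s \<otimes> F [^] (2::nat) \<in> P}"
begin

section \<open>The left-invariant order and the intervals \<open>[1, F^m]\<close>\<close>

definition le :: "'a \<Rightarrow> 'a \<Rightarrow> bool"  (infix "\<preceq>" 50) where
  "a \<preceq> b \<longleftrightarrow> inv a \<otimes> b \<in> P"

definition ival :: "nat \<Rightarrow> 'a set" where
  "ival m = {s \<in> P. s \<preceq> F [^] m}"

lemma P_closed [simp]: "a \<in> P \<Longrightarrow> a \<in> carrier G"
  using P_carrier by blast

lemma F_pow_P [simp]: "F [^] (m::nat) \<in> P"
  by (induction m) auto

lemma F_closed [simp]: "F \<in> carrier G"
  by simp

lemma F_pow_central:
  "x \<in> carrier G \<Longrightarrow> x \<otimes> F [^] (m::nat) = F [^] m \<otimes> x"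
  by (rule commute_nat_pow) (simp_all add: F_central)

lemma F_pow_left_commute:
  assumes "x \<in> carrier G" "y \<in> carrier G"
  shows "x \<otimes> (F [^] (m::nat) \<otimes> y) = F [^] m \<otimes> (x \<otimes> y)"
  using assms F_pow_central[of x m] by (simp flip: m_assoc)

lemma conj_F_pow:
  assumes "x \<in> carrier G" "h \<in> carrier G"
  shows "inv (F [^] (m::nat) \<otimes> h) \<otimes> x \<otimes> (F [^] m \<otimes> h) = inv h \<otimes> x \<otimes> h"
proof -
  have "x \<otimes> (F [^] m \<otimes> h) = F [^] m \<otimes> (x \<otimes> h)"
    using assms by (rule F_pow_left_commute)
  then show ?thesis
    using assms by (simp add: inv_mult_group m_assoc)
qed

lemma le_refl [simp]: "a \<in> carrier G \<Longrightarrow> a \<preceq> a"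
  by (simp add: le_def)

lemma le_trans [trans]:
  assumes "a \<preceq> b" "b \<preceq> c" "a \<in> carrier G" "b \<in> carrier G" "c \<in> carrier G"
  shows "a \<preceq> c"
proof -
  have "(inv a \<otimes> b) \<otimes> (inv b \<otimes> c) \<in> P"
    using assms mult_P[of "inv a \<otimes> b" "inv b \<otimes> c"] by (simp add: le_def)
  then show ?thesis
    using assms by (simp add: m_assoc le_def)
qed

lemma one_le_iff [simp]: "a \<in> carrier G \<Longrightarrow> \<one> \<preceq> a \<longleftrightarrow> a \<in> P"
  by (simp add: le_def)

lemma le_lmult_iff [simp]:
  assumes "a \<in> carrier G" "b \<in> carrier G" "c \<in> carrier G"
  shows "c \<otimes> a \<preceq> c \<otimes> b \<longleftrightarrow> a \<preceq> b"
  using assms by (simp add: le_def inv_mult_group m_assoc)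

lemma inv_lmult_le_iff:
  assumes "a \<in> carrier G" "b \<in> carrier G" "c \<in> carrier G"
  shows "inv c \<otimes> a \<preceq> b \<longleftrightarrow> a \<preceq> c \<otimes> b"
  using assms le_lmult_iff[of "inv c \<otimes> a" b c] by simp

lemma le_inv_lmult_iff:
  assumes "a \<in> carrier G" "b \<in> carrier G" "c \<in> carrier G"
  shows "a \<preceq> inv c \<otimes> b \<longleftrightarrow> c \<otimes> a \<preceq> b"
  using assms le_lmult_iff[of a "inv c \<otimes> b" c] by simp

lemma le_mult_P: "a \<in> carrier G \<Longrightarrow> p \<in> P \<Longrightarrow> a \<preceq> a \<otimes> p"
  by (simp add: le_def)

lemma le_F_pow_mult: "a \<in> carrier G \<Longrightarrow> a \<preceq> F [^] (m::nat) \<otimes> a"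
  using le_mult_P[of a "F [^] m"] by (simp add: F_pow_central)

lemma P_upward: "a \<in> P \<Longrightarrow> a \<preceq> b \<Longrightarrow> b \<in> carrier G \<Longrightarrow> b \<in> P"
  using mult_P[of a "inv a \<otimes> b"] by (simp add: le_def)

lemma le_antisym:
  assumes "a \<preceq> b" "b \<preceq> a" "a \<in> carrier G" "b \<in> carrier G"
  shows "a = b"
proof -
  have "inv a \<otimes> b = \<one>"
    by (rule P_pointed) (use assms in \<open>simp_all add: le_def inv_mult_group\<close>)
  then show ?thesis
    using assms(3,4) by (metis inv_mult_cancel(2) r_one)
qed

lemma F_pow_mono: "m \<le> n \<Longrightarrow> F [^] (m::nat) \<preceq> F [^] (n::nat)"
  using le_mult_P[of "F [^] m" "F [^] (n - m)"] by (simp add: nat_pow_mult)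

lemma ival_closed [simp]: "s \<in> ival m \<Longrightarrow> s \<in> carrier G"
  by (simp add: ival_def)

lemma ival_mono: "m \<le> n \<Longrightarrow> s \<in> ival m \<Longrightarrow> s \<in> ival n"
  using F_pow_mono[of m n] by (auto simp: ival_def intro: le_trans)

lemma F_pow_ival: "m \<le> n \<Longrightarrow> F [^] (m::nat) \<in> ival n"
  using F_pow_mono[of m n] by (simp add: ival_def)

text \<open>Since \<open>F\<close> is central,
  \<open>a b <= a F^n = F^n a <= F^n F^m\<close>.\<close>

lemma ival_mult:
  assumes "a \<in> ival m" "b \<in> ival n"
  shows "a \<otimes> b \<in> ival (m + n)"
proof -
  have ab: "a \<in> P" "b \<in> P" "a \<preceq> F [^] m" "b \<preceq> F [^] n"
    using assms by (auto simp: ival_def)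
  have "a \<otimes> b \<preceq> a \<otimes> F [^] n"
    using ab by simp
  also have "a \<otimes> F [^] n \<preceq> F [^] n \<otimes> F [^] m"
    using ab by (simp add: F_pow_central[of a])
  finally have "a \<otimes> b \<preceq> F [^] n \<otimes> F [^] m"
    using ab by simp
  then show ?thesis
    using ab by (simp add: ival_def nat_pow_mult add.commute)
qed

lemma ival_pow: "a \<in> ival m \<Longrightarrow> a [^] (k::nat) \<in> ival (k * m)"
proof (induction k)
  case 0
  show ?case by (simp add: ival_def)
next
  case (Suc k)
  then show ?case
    using ival_mult[of "a [^] k" "k * m" a m] by (simp add: add.commute)
qed

lemma ex_shift_ge:
  assumes "F [^] (k::nat) \<otimes> a \<in> P" "k \<le> m" "a \<in> carrier G"
  shows "F [^] m \<otimes> a \<in> P"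
  using mult_P[OF F_pow_P[of "m - k"] assms(1)] assms(2,3)
  by (simp add: nat_pow_mult flip: m_assoc)

section \<open>Joins, and conjugating a root into an interval\<close>

definition is_lub :: "'a \<Rightarrow> 'a set \<Rightarrow> bool" where
  "is_lub j A \<longleftrightarrow> j \<in> carrier G \<and> (\<forall>a\<in>A. a \<preceq> j) \<and>
     (\<forall>c\<in>carrier G. (\<forall>a\<in>A. a \<preceq> c) \<longrightarrow> j \<preceq> c)"

text \<open>Left translation by a common power of \<open>F\<close> preserves the order and moves
  both elements into the cone, where a join exists. An upper bound of positive elements is itself
  positive, so minimality inside the cone suffices.\<close>

lemma ex_lub2:
  assumes ab: "a \<in> carrier G" "b \<in> carrier G"
  shows "\<exists>j. is_lub j {a, b}"
proof -
  obtain k l :: nat where "F [^] k \<otimes> a \<in> P" "F [^] l \<otimes> b \<in> P"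
    using ab ex_shift by blast
  then have "F [^] (k + l) \<otimes> a \<in> P" "F [^] (k + l) \<otimes> b \<in> P"
    using ab by (auto intro: ex_shift_ge)
  then obtain m :: nat where m: "F [^] m \<otimes> a \<in> P" "F [^] m \<otimes> b \<in> P"
    by blast
  obtain j where j: "j \<in> P" "F [^] m \<otimes> a \<preceq> j" "F [^] m \<otimes> b \<preceq> j"
      "\<And>c. c \<in> P \<Longrightarrow> F [^] m \<otimes> a \<preceq> c \<Longrightarrow> F [^] m \<otimes> b \<preceq> c \<Longrightarrow> j \<preceq> c"
    using ex_join_P[OF m] by (auto simp: le_def)
  have "is_lub (inv (F [^] m) \<otimes> j) {a, b}"
    unfolding is_lub_def
  proof (intro conjI ballI impI)
    fix c assume c: "c \<in> carrier G" "\<forall>x\<in>{a, b}. x \<preceq> c"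
    then have "F [^] m \<otimes> c \<in> P"
      using ab m P_upward[of "F [^] m \<otimes> a" "F [^] m \<otimes> c"] by simp
    then show "inv (F [^] m) \<otimes> j \<preceq> c"
      using ab c j by (simp add: inv_lmult_le_iff)
  qed (use ab j in \<open>auto simp: le_inv_lmult_iff\<close>)
  then show ?thesis ..
qed

lemma ex_lub:
  assumes "finite A" "A \<noteq> {}" "A \<subseteq> carrier G"
  shows "\<exists>j. is_lub j A"
  using assms
proof (induction rule: finite_ne_induct)
  case (singleton x)
  then show ?case by (intro exI[of _ x]) (simp add: is_lub_def)
next
  case (insert x A)
  then obtain j where j: "is_lub j A" by auto
  then obtain i where i: "is_lub i {x, j}"
    using ex_lub2[of x j] insert.prems by (auto simp: is_lub_def)
  have "a \<preceq> i" if "a \<in> A" for a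
    using that i j insert.prems le_trans[of a j i] by (auto simp: is_lub_def)
  then have "is_lub i (insert x A)"
    using i j by (auto simp: is_lub_def)
  then show ?case ..
qed

text \<open>If \<open>h\<close> is a join, both inequalities can be tested on the members joined,
  since left translations preserve the order.\<close>

lemma conj_ival_iff:
  assumes "h \<in> carrier G" "x \<in> carrier G"
  shows "inv h \<otimes> x \<otimes> h \<in> ival m \<longleftrightarrow> h \<preceq> x \<otimes> h \<and> x \<otimes> h \<preceq> F [^] m \<otimes> h"
  using assms
  by (simp add: ival_def m_assoc inv_lmult_le_iff F_pow_central) (simp add: le_def)

text \<open>
  If \<open>x\<^sup>n\<close> lies in \<open>[1, F\<^sup>m]\<close> then so does the conjugate of \<open>x\<close> by the join \<open>h\<close> of
  \<open>1, x\<^sup>-\<^sup>1, \<dots>, x\<^sup>1\<^sup>-\<^sup>n\<close>: left multiplication by \<open>x\<close> shifts this family by one place, so both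
  \<open>h \<le> x h\<close> and \<open>x h \<le> F\<^sup>m h\<close> can be tested on its members.
\<close>

lemma root_conj_ival:
  assumes x: "x \<in> carrier G" and n: "n \<ge> 1" and xn: "x [^] (n::nat) \<in> ival m"
  shows "\<exists>h\<in>carrier G. inv h \<otimes> x \<otimes> h \<in> ival m"
proof -
  define A where "A = (\<lambda>i. inv (x [^] i)) ` {..<n}"
  have "A \<noteq> {}" "finite A" "A \<subseteq> carrier G"
    using n x by (auto simp: A_def lessThan_empty_iff)
  then obtain h where h: "is_lub h A"
    using ex_lub by blast
  have hc: "h \<in> carrier G" and ub: "\<And>i. i < n \<Longrightarrow> inv (x [^] i) \<preceq> h"
    and least: "\<And>c. c \<in> carrier G \<Longrightarrow> (\<And>i. i < n \<Longrightarrow> inv (x [^] i) \<preceq> c) \<Longrightarrow> h \<preceq> c"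
    using h by (auto simp: is_lub_def A_def)
  obtain k where k: "n = Suc k"
    using n by (cases n) auto
  have xSuc: "x \<otimes> inv (x [^] Suc i) = inv (x [^] i)" for i
    using x by (simp add: inv_mult_group)
  have "h \<preceq> x \<otimes> h"
  proof (rule least)
    fix i assume "i < n"
    show "inv (x [^] i) \<preceq> x \<otimes> h"
    proof (cases "Suc i < n")
      case True
      then have "x \<otimes> inv (x [^] Suc i) \<preceq> x \<otimes> h"
        using x hc ub[OF True] by (simp del: nat_pow_Suc)
      then show ?thesis
        by (simp only: xSuc)
    next
      \<comment> \<open>The last member is not the shift of another one; here
        \<open>x^n >= 1\<close> gives \<open>x^(1-n) <= x\<close>, and \<open>x <= x h\<close>
        because \<open>1 <= h\<close>.\<close>
      case False
      then have "i = k" using \<open>i < n\<close> k by simp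
      have "x [^] i \<otimes> x \<in> P"
        using xn k \<open>i = k\<close> by (simp add: ival_def)
      then have "inv (x [^] i) \<preceq> x"
        using x by (simp add: le_def)
      moreover have "x \<preceq> x \<otimes> h"
        using x hc ub[of 0] k le_lmult_iff[of \<one> h x] by simp
      ultimately show ?thesis
        using x hc by (auto intro: le_trans)
    qed
  qed (use x hc in simp)
  moreover have "h \<preceq> inv x \<otimes> (F [^] m \<otimes> h)"
  proof (rule least)
    fix i assume i: "i < n"
    have "x \<otimes> inv (x [^] i) \<preceq> F [^] m \<otimes> h"
    proof (cases i)
      \<comment> \<open>The first member is shifted to \<open>x\<close>, outside the family; here
        \<open>x^n <= F^m\<close> gives \<open>x <= F^m x^(1-n)\<close>.\<close>
      case 0
      have "x [^] k \<otimes> x \<preceq> F [^] m"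
        using xn k by (simp add: ival_def)
      then have "x \<preceq> inv (x [^] k) \<otimes> F [^] m"
        using x by (simp add: le_inv_lmult_iff)
      also have "inv (x [^] k) \<otimes> F [^] m = F [^] m \<otimes> inv (x [^] k)"
        using x by (simp add: F_pow_central)
      also have "\<dots> \<preceq> F [^] m \<otimes> h"
        using x hc ub[of k] k by simp
      finally show ?thesis
        using x hc 0 by simp
    next
      case (Suc j)
      have "inv (x [^] j) \<preceq> h" "h \<preceq> F [^] m \<otimes> h"
        using ub[of j] i Suc hc le_F_pow_mult by auto
      then have "inv (x [^] j) \<preceq> F [^] m \<otimes> h"
        using x hc by (auto intro: le_trans)
      then show ?thesis
        unfolding Suc xSuc .
    qed
    then show "inv (x [^] i) \<preceq> inv x \<otimes> (F [^] m \<otimes> h)"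
      using x hc by (simp add: le_inv_lmult_iff)
  qed (use x hc in simp)
  ultimately have "inv h \<otimes> x \<otimes> h \<in> ival m"
    using x hc by (simp add: conj_ival_iff le_inv_lmult_iff)
  then show ?thesis
    using hc by blast
qed

section \<open>Factorisation into simple elements\<close>

lemma ival_0: "ival 0 = {\<one>}"
  by (auto simp: ival_def le_def intro: P_pointed)

text \<open>The factor \<open>s\<close> is the join of 1 and \<open>u = F^(-2k) h\<close>.
  Conjugation by \<open>u\<close> equals conjugation by \<open>h\<close>, as \<open>F\<close> is
  central. For fixed \<open>g\<close>, the elements \<open>c\<close> with
  \<open>c <= g c <= F^m c\<close> are closed under joins and include 1 and \<open>u\<close>, hence
  \<open>s\<close>.\<close>

lemma ival_split:
  assumes h: "h \<in> ival (2 * Suc k)"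
  obtains s where "s \<in> ival 2" "inv s \<otimes> h \<in> ival (2 * k)"
    "\<And>g m. \<lbrakk>g \<in> ival m; inv h \<otimes> g \<otimes> h \<in> ival m\<rbrakk> \<Longrightarrow> inv s \<otimes> g \<otimes> s \<in> ival m"
proof -
  define u where "u = inv (F [^] (2 * k)) \<otimes> h"
  have hP: "h \<in> P" "h \<preceq> F [^] (2 * k + 2)"
    using h by (auto simp: ival_def)
  have uc: "u \<in> carrier G" and hu: "h = F [^] (2 * k) \<otimes> u"
    using hP by (auto simp: u_def)
  obtain s where s: "is_lub s {\<one>, u}"
    using ex_lub2[of \<one> u] uc by auto
  then have sc: "s \<in> carrier G" and sP: "s \<in> P" and us: "u \<preceq> s"
    and least: "\<And>c. c \<in> carrier G \<Longrightarrow> \<one> \<preceq> c \<Longrightarrow> u \<preceq> c \<Longrightarrow> s \<preceq> c"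
    by (auto simp: is_lub_def)
  have "F [^] (2 * k) \<otimes> u \<preceq> F [^] (2 * k) \<otimes> F [^] (2::nat)"
    using hP hu by (simp only: nat_pow_mult[OF F_closed])
  then have "u \<preceq> F [^] (2::nat)"
    using uc by simp
  then have "s \<preceq> F [^] (2::nat)"
    by (intro least) auto
  then have 1: "s \<in> ival 2"
    using sP by (simp add: ival_def)
  have "u \<preceq> h"
    using uc hu le_F_pow_mult by simp
  then have "s \<preceq> h"
    using hP by (intro least) auto
  moreover have "h \<preceq> s \<otimes> F [^] (2 * k)"
    using us uc sc by (simp add: hu F_pow_central)
  ultimately have 2: "inv s \<otimes> h \<in> ival (2 * k)"
    using hP sc by (simp add: ival_def inv_lmult_le_iff) (simp add: le_def)
  have 3: "inv s \<otimes> g \<otimes> s \<in> ival m" if g: "g \<in> ival m" "inv h \<otimes> g \<otimes> h \<in> ival m" for g m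
  proof -
    have gP: "g \<in> P" "g \<preceq> F [^] m"
      using g by (auto simp: ival_def)
    have "inv h \<otimes> g \<otimes> h = inv u \<otimes> g \<otimes> u"
      unfolding hu using gP uc by (simp add: conj_F_pow)
    then have u: "u \<preceq> g \<otimes> u" "g \<otimes> u \<preceq> F [^] m \<otimes> u"
      using g uc gP conj_ival_iff[of u g m] by auto
    have "s \<preceq> g \<otimes> s"
    proof (rule least)
      show "u \<preceq> g \<otimes> s"
        using u(1) us gP uc sc le_trans[of u "g \<otimes> u" "g \<otimes> s"] by simp
    qed (use gP sP in auto)
    moreover have "s \<preceq> inv g \<otimes> (F [^] m \<otimes> s)"
    proof (rule least)
      have "g \<preceq> F [^] m \<otimes> s"
        using gP sP le_mult_P[of "F [^] m" s] le_trans[of g "F [^] m" "F [^] m \<otimes> s"] by simp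
      then show "\<one> \<preceq> inv g \<otimes> (F [^] m \<otimes> s)"
        using gP sc by (simp add: le_inv_lmult_iff del: one_le_iff)
      have "g \<otimes> u \<preceq> F [^] m \<otimes> s"
        using u(2) us gP uc sc le_trans[of "g \<otimes> u" "F [^] m \<otimes> u" "F [^] m \<otimes> s"] by simp
      then show "u \<preceq> inv g \<otimes> (F [^] m \<otimes> s)"
        using gP sc uc by (simp add: le_inv_lmult_iff)
    qed (use gP sc in auto)
    ultimately show ?thesis
      using gP sc by (simp add: conj_ival_iff le_inv_lmult_iff)
  qed
  show ?thesis
    by (rule that[OF 1 2 3])
qed

lemma ival_eq_list_prod:
  "y \<in> ival (2 * k) \<Longrightarrow> \<exists>xs. set xs \<subseteq> ival 2 \<and> length xs = k \<and> list_prod G xs = y"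
proof (induction k arbitrary: y)
  case 0
  then show ?case by (intro exI[of _ "[]"]) (simp add: ival_0)
next
  case (Suc k)
  obtain s where s: "s \<in> ival 2" "inv s \<otimes> y \<in> ival (2 * k)"
    by (rule ival_split[OF Suc.prems])
  obtain xs where xs: "set xs \<subseteq> ival 2" "length xs = k" "list_prod G xs = inv s \<otimes> y"
    using Suc.IH[OF s(2)] by blast
  show ?case
    using s xs Suc.prems by (intro exI[of _ "s # xs"]) auto
qed

lemma finite_ival_2: "finite (ival 2)"
  using finite_simples by (simp add: ival_def le_def)

lemma finite_ival: "finite (ival (2 * k))" (is ?fin)
  and card_ival: "card (ival (2 * k)) \<le> card (ival 2) ^ k" (is ?card)
proof -
  let ?L = "{xs. set xs \<subseteq> ival 2 \<and> length xs = k}"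
  have *: "ival (2 * k) \<subseteq> list_prod G ` ?L" "finite ?L"
    using ival_eq_list_prod finite_ival_2 by (auto intro: finite_lists_length_eq)
  then show ?fin
    using finite_surj by blast
  show ?card
    using surj_card_le[OF *(2,1)] card_lists_length_eq[OF finite_ival_2] by simp
qed

section \<open>Chains of conjugations inside an interval\<close>

definition conj_step :: "nat \<Rightarrow> ('a \<times> 'a) set" where
  "conj_step m = {(a, b). a \<in> ival m \<and> b \<in> ival m \<and> (\<exists>s\<in>ival 2. b = inv s \<otimes> a \<otimes> s)}"

text \<open>Simple factors are split off \<open>h\<close> one by one; the last clause of
  \<open>ival_split\<close> keeps every intermediate conjugate inside the interval.\<close>

lemma conj_step_rtrancl:
  "\<lbrakk>h \<in> ival (2 * k); g \<in> ival m; inv h \<otimes> g \<otimes> h \<in> ival m\<rbrakk>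
    \<Longrightarrow> (g, inv h \<otimes> g \<otimes> h) \<in> (conj_step m)\<^sup>*"
proof (induction k arbitrary: h g)
  case 0
  then show ?case by (simp add: ival_0)
next
  case (Suc k)
  obtain s where s: "s \<in> ival 2" "inv s \<otimes> h \<in> ival (2 * k)" "inv s \<otimes> g \<otimes> s \<in> ival m"
    by (rule ival_split[OF Suc.prems(1)]) (use Suc.prems(2,3) in blast)
  have c: "s \<in> carrier G" "h \<in> carrier G" "g \<in> carrier G"
    using s Suc.prems ival_closed by blast+
  have eq: "inv (inv s \<otimes> h) \<otimes> (inv s \<otimes> g \<otimes> s) \<otimes> (inv s \<otimes> h) = inv h \<otimes> g \<otimes> h"
    using c by (simp add: inv_mult_group m_assoc)
  have "(g, inv s \<otimes> g \<otimes> s) \<in> conj_step m"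
    using s Suc.prems by (auto simp: conj_step_def)
  also have "(inv s \<otimes> g \<otimes> s, inv h \<otimes> g \<otimes> h) \<in> (conj_step m)\<^sup>*"
    using Suc.IH[OF s(2,3)] Suc.prems(3) unfolding eq by simp
  finally show ?case .
qed

lemma conj_step_relpow:
  assumes "a \<in> carrier G" "(a, b) \<in> conj_step m ^^ i"
  shows "\<exists>xs. set xs \<subseteq> ival 2 \<and> length xs = i \<and>
    list_prod G xs \<otimes> b \<otimes> inv (list_prod G xs) = a"
  using assms(2)
proof (induction i arbitrary: b)
  case 0
  then show ?case using assms(1) by (intro exI[of _ "[]"]) simp
next
  case (Suc i)
  then obtain c where c: "(a, c) \<in> conj_step m ^^ i" "(c, b) \<in> conj_step m"
    by auto
  obtain xs where xs: "set xs \<subseteq> ival 2" "length xs = i"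
      "list_prod G xs \<otimes> c \<otimes> inv (list_prod G xs) = a"
    using Suc.IH[OF c(1)] by blast
  obtain s where s: "s \<in> ival 2" "c \<in> ival m" "b = inv s \<otimes> c \<otimes> s"
    using c(2) by (auto simp: conj_step_def)
  have sx: "set xs \<subseteq> carrier G"
    using xs(1) ival_closed by blast
  have "list_prod G (xs @ [s]) \<otimes> b \<otimes> inv (list_prod G (xs @ [s])) = a"
    using sx s xs(3) by (simp add: list_prod_append inv_mult_group m_assoc)
  then show ?case
    using xs s by (intro exI[of _ "xs @ [s]"]) auto
qed

text \<open>Let \<open>y\<close> be the conjugate of \<open>x\<close> in the interval. Only the
  powers \<open>x^n\<close> and \<open>y^n\<close> are joined by a short chain. Its conjugator
  carries \<open>y\<close> to an \<open>n\<close>-th root of \<open>x^n\<close> that may differ from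
  \<open>x\<close>, but whose length is bounded.\<close>

lemma short_root:
  assumes x: "x \<in> carrier G" and n: "n \<ge> 1" and xn: "x [^] (n::nat) \<in> ival (2 * k)"
  obtains xs ys where "set xs \<subseteq> ival 2" "set ys \<subseteq> ival 2"
    "length xs \<le> card (ival 2) ^ (2 * k * n)" "length ys = k"
    "(list_prod G xs \<otimes> list_prod G ys \<otimes> inv (list_prod G xs)) [^] n = x [^] n"
proof -
  let ?m = "2 * (k * n)"
  obtain h where h: "h \<in> carrier G" "inv h \<otimes> x \<otimes> h \<in> ival (2 * k)"
    using root_conj_ival[OF x n xn] by blast
  define y where "y = inv h \<otimes> x \<otimes> h"
  obtain ys where ys: "set ys \<subseteq> ival 2" "length ys = k" "list_prod G ys = y"
    using ival_eq_list_prod[of y k] h(2) by (auto simp: y_def)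
  have yn: "y [^] n = inv h \<otimes> x [^] n \<otimes> h"
    using conj_nat_pow[of "inv h" x n] h x by (simp add: y_def)
  \<comment> \<open>With \<open>F^j h\<close> and \<open>F^j h^-1\<close> both positive,
    \<open>F^j h\<close> lies in \<open>[1, F^(2j)]\<close>; being central, \<open>F^j\<close> does
    not affect the conjugation.\<close>
  obtain j0 j1 :: nat where "F [^] j0 \<otimes> h \<in> P" "F [^] j1 \<otimes> inv h \<in> P"
    using ex_shift[OF h(1)] ex_shift[OF inv_closed[OF h(1)]] by blast
  then have j: "F [^] (j0 + j1) \<otimes> h \<in> P" "F [^] (j0 + j1) \<otimes> inv h \<in> P"
    using h by (auto intro: ex_shift_ge)
  define j where "j = j0 + j1"
  have "inv (F [^] j \<otimes> h) \<otimes> F [^] (2 * j) = F [^] j \<otimes> inv h"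
    using h F_pow_central[of "inv h" j]
    by (simp add: inv_mult_group m_assoc mult_2 flip: nat_pow_mult)
  then have hj: "F [^] j \<otimes> h \<in> ival (2 * j)"
    using j by (simp add: ival_def le_def j_def)
  have conj: "inv (F [^] j \<otimes> h) \<otimes> x [^] n \<otimes> (F [^] j \<otimes> h) = y [^] n"
    using h x by (simp add: yn conj_F_pow)
  have "y [^] n \<in> ival ?m"
    using ival_pow[of y "2 * k" n] h by (simp add: y_def mult.assoc mult.left_commute mult.commute)
  moreover have "x [^] n \<in> ival ?m"
    using xn n ival_mono[of "2 * k" ?m] by simp
  ultimately have star: "(x [^] n, y [^] n) \<in> (conj_step ?m)\<^sup>*"
    using conj_step_rtrancl[OF hj, of "x [^] n" ?m] conj by simp
  \<comment> \<open>Both ends of a step lie in a finite interval, so the relation is finite, and a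
    chain can be chosen no longer than its number of pairs.\<close>
  have sub: "conj_step ?m \<subseteq> ival ?m \<times> ival ?m"
    by (auto simp: conj_step_def)
  have fin: "finite (conj_step ?m)"
    using finite_subset[OF sub] finite_ival by blast
  have "card (conj_step ?m) \<le> card (ival ?m) * card (ival ?m)"
    using card_mono[OF _ sub] finite_ival by (simp add: card_cartesian_product)
  also have "\<dots> \<le> card (ival 2) ^ (k * n) * card (ival 2) ^ (k * n)"
    by (intro mult_le_mono card_ival)
  finally have card: "card (conj_step ?m) \<le> card (ival 2) ^ (2 * k * n)"
    by (simp add: mult_2 add_mult_distrib power_add)
  obtain i where i: "i \<le> card (conj_step ?m)" "(x [^] n, y [^] n) \<in> conj_step ?m ^^ i"
    using star rtrancl_finite_eq_relpow[OF fin] by auto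
  obtain xs where xs: "set xs \<subseteq> ival 2" "length xs = i"
      "list_prod G xs \<otimes> y [^] n \<otimes> inv (list_prod G xs) = x [^] n"
    using conj_step_relpow[OF nat_pow_closed[OF x] i(2)] by blast
  have "list_prod G xs \<in> carrier G" "y \<in> carrier G"
    using xs(1) h x ival_closed by (auto simp: y_def intro!: list_prod_closed)
  then have "(list_prod G xs \<otimes> list_prod G ys \<otimes> inv (list_prod G xs)) [^] n = x [^] n"
    using xs(3) by (simp add: ys(3) conj_nat_pow)
  then show ?thesis
    using that[OF xs(1) ys(1)] xs(2) ys(2) i(1) card by simp
qed

end

section \<open>Deciding the root problem in a cone\<close>

definition crev :: "nat \<Rightarrow> nat" where
  "crev c = cfold (\<lambda>acc x. ccons x acc) 0 c"

lemma list_decode_crev [simp]: "list_decode (crev c) = rev (list_decode c)"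
proof -
  have "list_decode (foldl (\<lambda>acc x. ccons x acc) a xs) = rev xs @ list_decode a" for a xs
    by (induction xs arbitrary: a) auto
  then show ?thesis by (simp add: crev_def cfold_def)
qed

lemma computable_crev: "computable k f \<Longrightarrow> computable k (\<lambda>xs. crev (f xs))"
  unfolding crev_def
  by (rule computable_cfold) (intro computable_ccons computable_intros; simp)+

text \<open>Building the result by consing reverses the order, hence the preliminary
  reversal.\<close>

definition cmap :: "(nat \<Rightarrow> nat) \<Rightarrow> nat \<Rightarrow> nat" where
  "cmap f c = cfold (\<lambda>acc x. ccons (f x) acc) 0 (crev c)"

lemma list_decode_cmap [simp]: "list_decode (cmap f c) = map f (list_decode c)"
proof -
  have "list_decode (foldl (\<lambda>acc x. ccons (f x) acc) a xs) = rev (map f xs) @ list_decode a" for a xs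
    by (induction xs arbitrary: a) auto
  then show ?thesis by (simp add: cmap_def cfold_def rev_map)
qed

lemma computable_cmap:
  assumes "computable1 f" "computable k g"
  shows "computable k (\<lambda>xs. cmap f (g xs))"
  unfolding cmap_def
  by (rule computable_cfold)
    (intro computable_ccons computable_crev computable_app1[OF assms(1)] computable_intros assms; simp)+

text \<open>With an indicator for \<open>f\<close> the sum vanishes exactly if no entry has the
  property; with the constant 1 it is the length.\<close>

definition csum :: "(nat \<Rightarrow> nat) \<Rightarrow> nat \<Rightarrow> nat" where
  "csum f c = cfold (\<lambda>acc x. acc + f x) 0 c"

lemma csum_eq: "csum f c = sum_list (map f (list_decode c))"
proof -
  have "foldl (\<lambda>acc x. acc + f x) a xs = a + sum_list (map f xs)" for a xs
    by (induction xs arbitrary: a) auto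
  then show ?thesis by (simp add: csum_def cfold_def)
qed

lemma computable_csum:
  assumes "computable1 f" "computable k g"
  shows "computable k (\<lambda>xs. csum f (g xs))"
  unfolding csum_def
  by (rule computable_cfold)
    (intro computable_app1[OF assms(1)] computable_intros assms; simp)+

text \<open>The code of \<open>k\<close> copies of \<open>q\<close>. By monotonicity of pairing it
  is the largest code of a list of length at most \<open>k\<close> with entries at most
  \<open>q\<close>.\<close>

definition code_bound :: "nat \<Rightarrow> nat \<Rightarrow> nat" where
  "code_bound q k = (ccons q ^^ k) 0"

lemma computable_code_bound:
  "computable k f \<Longrightarrow> computable k (\<lambda>xs. code_bound q (f xs))"
  unfolding code_bound_def
  by (rule computable_funpow[of ccons k f "\<lambda>_. q" "\<lambda>_. 0"])
    (assumption | intro computable_ccons computable_intros; simp)+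

lemma list_encode_le_code_bound:
  "\<lbrakk>\<And>x. x \<in> set xs \<Longrightarrow> x \<le> q; length xs \<le> k\<rbrakk> \<Longrightarrow> list_encode xs \<le> code_bound q k"
proof (induction xs arbitrary: k)
  case (Cons x xs)
  then obtain j where j: "k = Suc j" "length xs \<le> j"
    by (cases k) auto
  then have "list_encode xs \<le> code_bound q j" "x \<le> q"
    using Cons by auto
  then have "prod_encode (x, list_encode xs) \<le> prod_encode (q, code_bound q j)"
    by (simp add: prod_encode_def add_mono triangle_mono)
  then show ?case
    by (simp add: j code_bound_def ccons_def)
qed simp

lemma list_decode_word_code:
  "list_decode (word_code w) = map (\<lambda>(i, b). 2 * i + of_bool b) w"
  by (simp add: word_code_def)

definition letters :: "nat list \<Rightarrow> gword" where
  "letters ls = map (\<lambda>l. (l div 2, odd l)) ls"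

lemma letters_list_decode_word_code [simp]: "letters (list_decode (word_code w)) = w"
  unfolding letters_def list_decode_word_code map_map by (rule map_idI) auto

lemma word_code_letters [simp]: "word_code (letters ls) = list_encode ls"
  by (simp add: word_code_def letters_def o_def flip: mod_2_eq_odd)

lemma valid_word_letters: "valid_word gs (letters ls) \<longleftrightarrow> (\<forall>l\<in>set ls. l < 2 * length gs)"
  by (auto simp: valid_word_def letters_def)

locale cone_with_generators = central_cone +
  fixes gs :: "'a list"
  assumes gs_closed: "set gs \<subseteq> carrier G"
    and gs_generate: "generate G (set gs) = carrier G"
    and F_gs: "g \<in> set gs \<Longrightarrow> F \<otimes> g \<in> P"
    and F_inv_gs: "g \<in> set gs \<Longrightarrow> F \<otimes> inv g \<in> P"
begin

section \<open>Words in the generators and word length\<close>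

abbreviation letter :: "nat \<Rightarrow> 'a" where
  "letter l \<equiv> letter_val G gs (l div 2, odd l)"

definition valid :: "nat list \<Rightarrow> bool" where
  "valid ls \<longleftrightarrow> (\<forall>l\<in>set ls. l < 2 * length gs)"

definition ev :: "nat list \<Rightarrow> 'a" where
  "ev ls = list_prod G (map letter ls)"

lemma ev_simps [simp]: "ev [] = \<one>" "ev (l # ls) = letter l \<otimes> ev ls"
  by (simp_all add: ev_def)

lemma valid_simps [simp]: "valid []" "valid (l # ls) \<longleftrightarrow> l < 2 * length gs \<and> valid ls"
  "valid (ls @ ms) \<longleftrightarrow> valid ls \<and> valid ms"
  by (auto simp: valid_def)

lemma word_val_letters: "word_val G gs (letters ls) = ev ls"
  by (simp add: word_val_def ev_def letters_def o_def)

lemma gs_nth_closed: "l < 2 * length gs \<Longrightarrow> gs ! (l div 2) \<in> set gs"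
  by (intro nth_mem) simp

lemma gs_nth_carrier: "l < 2 * length gs \<Longrightarrow> gs ! (l div 2) \<in> carrier G"
  using gs_nth_closed gs_closed by blast

lemma letter_closed [simp]: "l < 2 * length gs \<Longrightarrow> letter l \<in> carrier G"
  using gs_nth_carrier[of l] by (simp add: letter_val_def)

lemma ev_closed [simp]: "valid ls \<Longrightarrow> ev ls \<in> carrier G"
  by (induction ls) auto

lemma ev_append: "\<lbrakk>valid ls; valid ms\<rbrakk> \<Longrightarrow> ev (ls @ ms) = ev ls \<otimes> ev ms"
  by (induction ls) (auto simp: m_assoc)

definition short :: "nat \<Rightarrow> 'a set" where
  "short k = {g. \<exists>ls. valid ls \<and> length ls \<le> k \<and> ev ls = g}"

lemma short_mono: "g \<in> short j \<Longrightarrow> j \<le> k \<Longrightarrow> g \<in> short k"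
  unfolding short_def by (auto intro: order_trans)

lemma short_one [simp]: "\<one> \<in> short k"
  unfolding short_def by (auto intro!: exI[of _ "[]"])

lemma short_mult: "\<lbrakk>g \<in> short j; h \<in> short k\<rbrakk> \<Longrightarrow> g \<otimes> h \<in> short (j + k)"
  unfolding short_def by (clarify, rule_tac x = "ls @ lsa" in exI) (simp add: ev_append)

lemma short_letter: "l < 2 * length gs \<Longrightarrow> letter l \<in> short 1"
  unfolding short_def by (auto intro!: exI[of _ "[l]"])

lemma short_inv:
  assumes "g \<in> short k"
  shows "inv g \<in> short k"
proof -
  have "inv (ev ls) \<in> short (length ls)" if "valid ls" for ls
    using that
  proof (induction ls)
    case (Cons l ls)
    have l: "l < 2 * length gs"
      using Cons.prems by simp
    \<comment> \<open>A letter and its inverse have numbers that differ in the last bit.\<close>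
    define l' where "l' = (if odd l then l - 1 else Suc l)"
    have "l' < 2 * length gs" "letter l' = inv (letter l)"
      using l gs_nth_carrier[OF l]
      by (auto simp: l'_def letter_val_def elim!: evenE oddE)
    then have "inv (letter l) \<in> short 1"
      using short_letter[of l'] by simp
    then show ?case
      using Cons short_mult[of "inv (ev ls)" "length ls" "inv (letter l)" 1]
      by (simp add: inv_mult_group)
  qed simp
  then show ?thesis
    using assms short_mono by (force simp: short_def)
qed

lemma ex_short: "g \<in> carrier G \<Longrightarrow> \<exists>k. g \<in> short k"
proof -
  have gen: "\<exists>k. h \<in> short k" if h: "h \<in> set gs" for h
  proof -
    obtain i where "i < length gs" "gs ! i = h"
      using h by (auto simp: in_set_conv_nth)
    then show ?thesis
      using short_letter[of "2 * i"] by (auto simp: letter_val_def)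
  qed
  have "\<exists>k. g \<in> short k" if "g \<in> generate G (set gs)" for g
    using that
    by (induction rule: generate.induct) (blast intro: short_one short_inv short_mult dest: gen)+
  then show "g \<in> carrier G \<Longrightarrow> \<exists>k. g \<in> short k"
    using gs_generate by blast
qed

text \<open>A maximum over the finite set of simple elements; it enters the length bound of the
  search as a fixed constant.\<close>

lemma ex_short_ival: "\<exists>k. ival 2 \<subseteq> short k"
proof -
  obtain f where f: "\<And>g. g \<in> carrier G \<Longrightarrow> g \<in> short (f g)"
    using ex_short by metis
  have "g \<in> short (Max (f ` ival 2))" if "g \<in> ival 2" for g
    by (rule short_mono[OF f]) (use that finite_ival_2 in auto)
  then show ?thesis by blast
qed

lemma short_list_prod: "set xs \<subseteq> short k \<Longrightarrow> list_prod G xs \<in> short (length xs * k)"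
  by (induction xs) (auto intro: short_mult)

lemma short_pow: "g \<in> short k \<Longrightarrow> g [^] (n::nat) \<in> short (n * k)"
proof (induction n)
  case (Suc n)
  then show ?case
    using short_mult[of "g [^] n" "n * k" g k] by (simp add: add.commute)
qed simp

text \<open>The complement of \<open>F g\<close> in \<open>F^2\<close> is \<open>F g^-1\<close>, so
  positivity of both places \<open>F g\<close> in the interval.\<close>

lemma F_letter_ival:
  assumes "l < 2 * length gs"
  shows "F \<otimes> letter l \<in> ival 2"
proof -
  have l: "gs ! (l div 2) \<in> set gs" "gs ! (l div 2) \<in> carrier G"
    using gs_nth_closed[OF assms] gs_closed by auto
  have *: "F \<otimes> g \<in> ival 2" if "F \<otimes> g \<in> P" "F \<otimes> inv g \<in> P" "g \<in> carrier G" for g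
  proof -
    have "inv (F \<otimes> g) \<otimes> F [^] (2::nat) = F \<otimes> inv g"
      using that F_central[of "inv g"] by (simp add: inv_mult_group m_assoc numeral_2_eq_2)
    then show ?thesis
      using that by (simp add: ival_def le_def)
  qed
  show ?thesis
    using *[of "gs ! (l div 2)"] *[of "inv (gs ! (l div 2))"] F_gs F_inv_gs l
    by (auto simp: letter_val_def)
qed

lemma F_pow_ev_ival: "valid ls \<Longrightarrow> F [^] length ls \<otimes> ev ls \<in> ival (2 * length ls)"
proof (induction ls)
  case (Cons l ls)
  have "(F \<otimes> letter l) \<otimes> (F [^] length ls \<otimes> ev ls) \<in> ival (2 + 2 * length ls)"
    using Cons F_letter_ival by (intro ival_mult) auto
  moreover have "(F \<otimes> letter l) \<otimes> (F [^] length ls \<otimes> ev ls) =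
      F [^] length (l # ls) \<otimes> ev (l # ls)"
    using Cons.prems F_pow_left_commute[of "letter l" "ev ls" "length ls"]
      F_central[of "F [^] length ls"]
    by (simp add: m_assoc)
  ultimately show ?case by simp
qed (simp add: ival_0)

lemma F_pow_mult_pow:
  assumes "x \<in> carrier G"
  shows "(F [^] (m::nat) \<otimes> x) [^] (n::nat) = F [^] (m * n) \<otimes> x [^] n"
  using assms F_pow_central[of x m] pow_mult_distrib[of "F [^] m" x n] by (simp add: nat_pow_pow)

text \<open>Replaces \<open>x\<close> by \<open>F^m x\<close>, with \<open>m\<close> the length of
  \<open>ls\<close>, applies \<open>short_root\<close>, and divides the new root by
  \<open>F^m\<close> again. The bound uses \<open>c\<close> instead of the length; the program will
  take the code of the word for it.\<close>

lemma short_root_ev: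
  assumes E: "ival 2 \<subseteq> short d" and ls: "valid ls" and n: "n \<ge> 1"
    and x: "x \<in> carrier G" "x [^] n = ev ls" and c: "length ls \<le> c"
  shows "\<exists>ms. valid ms \<and> ev ms [^] n = ev ls \<and>
    length ms \<le> d * (c + 2 * card (ival 2) ^ (2 * (c * n) * n) + c * n)"
proof -
  let ?m = "length ls"
  let ?r = "card (ival 2)"
  obtain n' where n': "n = Suc n'"
    using n by (cases n) auto
  define x1 where "x1 = F [^] ?m \<otimes> x"
  have x1: "x1 \<in> carrier G" "x1 [^] n = F [^] (?m * n) \<otimes> ev ls"
    using x by (simp_all add: x1_def F_pow_mult_pow)
  \<comment> \<open>Of the \<open>m n\<close> factors \<open>F\<close>, with \<open>m\<close> the
    length, \<open>m\<close> serve to make the word positive and \<open>m n'\<close> are left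
    over.\<close>
  have "F [^] (?m * n') \<otimes> (F [^] ?m \<otimes> ev ls) \<in> ival (?m * n' + 2 * ?m)"
    by (intro ival_mult F_pow_ev_ival ls F_pow_ival order_refl)
  moreover have "F [^] (?m * n') \<otimes> (F [^] ?m \<otimes> ev ls) = x1 [^] n"
    unfolding x1(2) using ls by (simp add: n' nat_pow_mult add.commute flip: m_assoc)
  ultimately have "x1 [^] n \<in> ival (2 * (?m * n))"
    using ival_mono[of "?m * n' + 2 * ?m" "2 * (?m * n)" "x1 [^] n"] by (simp add: n')
  then obtain xs ys where xy: "set xs \<subseteq> ival 2" "set ys \<subseteq> ival 2"
    "length xs \<le> ?r ^ (2 * (?m * n) * n)" "length ys = ?m * n"
    "(list_prod G xs \<otimes> list_prod G ys \<otimes> inv (list_prod G xs)) [^] n = x1 [^] n"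
    using short_root[OF x1(1) n] by metis
  define h where "h = list_prod G xs"
  define y where "y = list_prod G ys"
  have hy: "h \<in> carrier G" "y \<in> carrier G"
    unfolding h_def y_def using xy ival_closed by (auto intro!: list_prod_closed)
  define z where "z = inv (F [^] ?m) \<otimes> (h \<otimes> y \<otimes> inv h)"
  have "F [^] ?m \<otimes> z = h \<otimes> y \<otimes> inv h" "z \<in> carrier G"
    using hy by (simp_all add: z_def)
  then have "F [^] (?m * n) \<otimes> z [^] n = F [^] (?m * n) \<otimes> ev ls"
    using xy(5) F_pow_mult_pow[of z ?m n] x1(2) by (simp add: h_def y_def)
  then have zn: "z [^] n = ev ls"
    using \<open>z \<in> carrier G\<close> ls by simp
  have "F \<in> short d"
    using E F_pow_ival[of 1 2] by auto
  then have "z \<in> short (?m * d + (length xs * d + length ys * d + length xs * d))"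
    unfolding z_def h_def y_def using E xy
    by (intro short_mult short_inv short_pow short_list_prod) auto
  then obtain ms where ms: "valid ms" "ev ms = z"
      "length ms \<le> d * (?m + 2 * length xs + length ys)"
    by (auto simp: short_def algebra_simps)
  have "?r \<ge> 1"
    using finite_ival_2 F_pow_ival[of 0 2] by (auto simp: card_gt_0_iff Suc_le_eq)
  then have "?r ^ (2 * (?m * n) * n) \<le> ?r ^ (2 * (c * n) * n)"
    using c by (intro power_increasing mult_le_mono) auto
  then have "?m + 2 * length xs + length ys \<le> c + 2 * ?r ^ (2 * (c * n) * n) + c * n"
    using xy(3,4) c by (intro add_mono mult_le_mono) auto
  then have "length ms \<le> d * (c + 2 * ?r ^ (2 * (c * n) * n) + c * n)"
    using ms(3) by (meson mult_le_mono2 order_trans)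
  then show ?thesis
    using ms zn by auto
qed

section \<open>Simple elements as numbers, and left division by a transducer\<close>

definition simples :: "'a list" where
  "simples = (SOME es. set es = ival 2)"

text \<open>The default value 1 makes every table over such numbers constant from
  \<open>length simples\<close> on.\<close>

definition dec :: "nat \<Rightarrow> 'a" where
  "dec k = (if k < length simples then simples ! k else \<one>)"

definition enc :: "'a \<Rightarrow> nat" where
  "enc s = (SOME k. dec k = s)"

lemma set_simples: "set simples = ival 2"
  unfolding simples_def using finite_list[OF finite_ival_2] by (rule someI_ex)

lemma dec_ival [simp]: "dec k \<in> ival 2"
  using F_pow_ival[of 0 2] set_simples nth_mem[of k simples] unfolding dec_def by auto

lemma dec_P [simp]: "dec k \<in> P" and dec_le: "dec k \<preceq> F [^] (2::nat)"
  using dec_ival[of k] unfolding ival_def by auto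

lemma dec_enc [simp]:
  assumes "s \<in> ival 2"
  shows "dec (enc s) = s"
  unfolding enc_def
proof (rule someI_ex)
  obtain k where "k < length simples" "simples ! k = s"
    using assms set_simples by (metis in_set_conv_nth)
  then show "\<exists>k. dec k = s"
    by (intro exI[of _ k]) (simp add: dec_def)
qed

definition join :: "'a \<Rightarrow> 'a \<Rightarrow> 'a" where
  "join a b = (SOME j. is_lub j {a, b})"

lemma join_lub: "\<lbrakk>a \<in> carrier G; b \<in> carrier G\<rbrakk> \<Longrightarrow> is_lub (join a b) {a, b}"
  unfolding join_def using ex_lub2 by (rule someI_ex)

text \<open>The two complements of a join \<open>j\<close>: after decoding, \<open>s\<close>
  followed by \<open>emit s t\<close> and \<open>t\<close> followed by \<open>next_state s t\<close>
  both multiply to \<open>j\<close>.\<close>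

definition next_state :: "nat \<Rightarrow> nat \<Rightarrow> nat" where
  "next_state s t = enc (inv (dec t) \<otimes> join (dec s) (dec t))"

definition emit :: "nat \<Rightarrow> nat \<Rightarrow> nat" where
  "emit s t = enc (inv (dec s) \<otimes> join (dec s) (dec t))"

text \<open>Centrality gives \<open>j <= F^2 <= F^2 t = t F^2\<close>, so the complement is bounded
  by \<open>F^2\<close>.\<close>

lemma compl_ival:
  assumes "j \<preceq> F [^] (2::nat)" "j \<in> carrier G" "t \<in> P" "t \<preceq> j"
  shows "inv t \<otimes> j \<in> ival 2"
proof -
  have "F [^] (2::nat) \<preceq> t \<otimes> F [^] (2::nat)"
    using assms F_pow_central[of t] le_mult_P[of "F [^] (2::nat)" t] by simp
  then have "j \<preceq> t \<otimes> F [^] (2::nat)"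
    using assms le_trans[of j "F [^] (2::nat)" "t \<otimes> F [^] (2::nat)"] by simp
  then show ?thesis
    using assms by (simp add: ival_def inv_lmult_le_iff) (simp add: le_def)
qed

lemma dec_next_state: "dec (next_state s t) = inv (dec t) \<otimes> join (dec s) (dec t)"
  and dec_emit: "dec (emit s t) = inv (dec s) \<otimes> join (dec s) (dec t)"
proof -
  have "is_lub (join (dec s) (dec t)) {dec s, dec t}"
    by (simp add: join_lub)
  then have "join (dec s) (dec t) \<preceq> F [^] (2::nat)" "join (dec s) (dec t) \<in> carrier G"
      "dec s \<preceq> join (dec s) (dec t)" "dec t \<preceq> join (dec s) (dec t)"
    using dec_le by (auto simp: is_lub_def)
  then show "dec (next_state s t) = inv (dec t) \<otimes> join (dec s) (dec t)"
      "dec (emit s t) = inv (dec s) \<otimes> join (dec s) (dec t)"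
    by (simp_all add: next_state_def emit_def compl_ival)
qed

lemma computable2_next_state: "computable2 next_state"
  by (rule computable2_eventually_const[of "length simples"])
    (simp_all add: next_state_def dec_def)

lemma computable2_emit: "computable2 emit"
  by (rule computable2_eventually_const[of "length simples"])
    (simp_all add: emit_def dec_def)

definition nontrivial :: "nat \<Rightarrow> nat" where
  "nontrivial k = of_bool (dec k \<noteq> \<one>)"

lemma nontrivial_eq_0 [simp]: "nontrivial k = 0 \<longleftrightarrow> dec k = \<one>"
  by (simp add: nontrivial_def)

lemma computable1_nontrivial: "computable1 nontrivial"
  by (rule computable1_eventually_const[of "length simples"])
    (simp add: nontrivial_def dec_def)

definition val :: "nat list \<Rightarrow> 'a" where
  "val ts = list_prod G (map dec ts)"

lemma val_simps [simp]: "val [] = \<one>" "val (t # ts) = dec t \<otimes> val ts"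
  by (simp_all add: val_def)

lemma val_P [simp]: "val ts \<in> P"
  by (induction ts) auto

lemma val_append: "val (ts @ us) = val ts \<otimes> val us"
  by (induction ts) (auto simp: m_assoc)

lemma val_replicate: "val (replicate n t) = dec t [^] n"
proof (induction n)
  case (Suc n)
  then show ?case
    using nat_pow_Suc2[of "dec t" n] by simp
qed simp

text \<open>If a product of positive elements is 1, the inverse of its first factor is positive,
  hence that factor is 1. A value can therefore be compared with 1 letter by letter.\<close>

lemma val_eq_one_iff: "val ts = \<one> \<longleftrightarrow> (\<forall>t\<in>set ts. dec t = \<one>)"
proof (induction ts)
  case (Cons t ts)
  have "dec t = \<one>" if "dec t \<otimes> val ts = \<one>"
  proof (rule P_pointed)
    have "inv (dec t) = val ts"
      using that by (intro inv_equality) (auto simp: r_inv_ex inv_comm)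
    then show "inv (dec t) \<in> P" by simp
  qed simp
  then show ?case
    using Cons by auto
qed simp

text \<open>\<open>z\<close> pairs the current state with the output so far, whose latest letter
  comes first.\<close>

definition trans_step :: "nat \<Rightarrow> nat \<Rightarrow> nat" where
  "trans_step z t = prod_encode (next_state (pfst z) t, ccons (emit (pfst z) t) (psnd z))"

text \<open>
  The step is \<open>s\<^sup>-\<^sup>1 t v = (s\<^sup>-\<^sup>1 (s \<or> t)) (t\<^sup>-\<^sup>1 (s \<or> t))\<^sup>-\<^sup>1 v\<close>: one complement is written
  to the output, the other is carried on as the state.
\<close>

lemma trans_correct:
  "\<exists>out. list_decode (psnd (foldl trans_step (prod_encode (s, acc)) ts)) = rev out @ list_decode acc \<and>
     (dec s \<preceq> val ts \<longleftrightarrow> dec (pfst (foldl trans_step (prod_encode (s, acc)) ts)) = \<one>) \<and>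
     (dec (pfst (foldl trans_step (prod_encode (s, acc)) ts)) = \<one> \<longrightarrow> dec s \<otimes> val out = val ts)"
proof (induction ts arbitrary: s acc)
  case Nil
  have "dec s \<preceq> \<one> \<longleftrightarrow> dec s = \<one>"
    using le_antisym[of "dec s" \<one>] by auto
  then show ?case by (intro exI[of _ "[]"]) simp
next
  case (Cons t ts)
  let ?j = "join (dec s) (dec t)" and ?s = "next_state s t"
  let ?z = "foldl trans_step (prod_encode (?s, ccons (emit s t) acc)) ts"
  have z: "foldl trans_step (prod_encode (s, acc)) (t # ts) = ?z"
    by (simp add: trans_step_def)
  obtain out where out: "list_decode (psnd ?z) = rev out @ emit s t # list_decode acc"
    "dec ?s \<preceq> val ts \<longleftrightarrow> dec (pfst ?z) = \<one>"
    "dec (pfst ?z) = \<one> \<Longrightarrow> dec ?s \<otimes> val out = val ts"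
    using Cons.IH[of ?s "ccons (emit s t) acc"] by auto
  have lub: "is_lub ?j {dec s, dec t}"
    by (simp add: join_lub)
  then have j: "?j \<in> carrier G" "dec s \<preceq> ?j"
    by (auto simp: is_lub_def)
  \<comment> \<open>The right side is a multiple of \<open>dec t\<close> already, so divisibility by
    \<open>dec s\<close> amounts to divisibility by the join.\<close>
  have "dec t \<preceq> dec t \<otimes> val ts"
    by (simp add: le_mult_P)
  then have "dec s \<preceq> dec t \<otimes> val ts \<longleftrightarrow> ?j \<preceq> dec t \<otimes> val ts"
    using lub j le_trans[of "dec s" ?j "dec t \<otimes> val ts"] by (auto simp: is_lub_def)
  also have "\<dots> \<longleftrightarrow> dec ?s \<preceq> val ts"
    using j by (simp add: dec_next_state inv_lmult_le_iff)
  finally have iff: "dec s \<preceq> dec t \<otimes> val ts \<longleftrightarrow> dec (pfst ?z) = \<one>"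
    using out(2) by simp
  have "dec s \<otimes> (dec (emit s t) \<otimes> val out) = dec t \<otimes> (dec ?s \<otimes> val out)"
    using j by (simp add: dec_emit dec_next_state m_assoc)
  then show ?case
    unfolding z using out iff by (intro exI[of _ "emit s t # out"]) auto
qed

text \<open>
  A state pairs a failure count with a word over the simples. With count zero it stands for
  the value of the word, otherwise for an element outside the cone.
\<close>

definition rep :: "nat \<Rightarrow> 'a \<Rightarrow> bool" where
  "rep st g \<longleftrightarrow> (if pfst st = 0 then val (list_decode (psnd st)) = g else g \<notin> P)"

text \<open>A nontrivial final state signals that the division failed, and the count never
  decreases. The output is reversed since the transducer writes its latest letter first.\<close>

definition divide :: "nat \<Rightarrow> nat \<Rightarrow> nat" where
  "divide st s = prod_encode
     (pfst st + nontrivial (pfst (cfold trans_step (prod_encode (s, 0)) (psnd st))),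
      crev (psnd (cfold trans_step (prod_encode (s, 0)) (psnd st))))"

text \<open>Inside the cone \<open>trans_correct\<close> applies. Outside, no division leads back: a
  positive quotient times the positive \<open>dec s\<close> would be positive.\<close>

lemma rep_divide:
  assumes "rep st g" "g \<in> carrier G"
  shows "rep (divide st s) (inv (dec s) \<otimes> g)"
proof (cases "pfst st = 0")
  case True
  then have g: "val (list_decode (psnd st)) = g"
    using assms by (simp add: rep_def)
  have "val out = inv (dec s) \<otimes> g" if "dec s \<otimes> val out = g" for out
    using that by auto
  then show ?thesis
    using trans_correct[of s 0 "list_decode (psnd st)"] True
    by (auto simp: rep_def divide_def cfold_def le_def g)
next
  case False
  then have "g \<notin> P"
    using assms by (simp add: rep_def)
  then have "inv (dec s) \<otimes> g \<notin> P"
    using mult_P[of "dec s" "inv (dec s) \<otimes> g"] assms(2) by auto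
  then show ?thesis
    using False by (simp add: rep_def divide_def)
qed

lemma computable2_divide: "computable2 divide"
proof -
  have "computable2 trans_step"
    unfolding trans_step_def
    by (intro computable_prod_encode computable_ccons computable_pfst computable_psnd
        computable_app2[OF computable2_next_state] computable_app2[OF computable2_emit]
        computable_nth; simp)
  then show ?thesis
    unfolding divide_def
    by (intro computable_prod_encode computable_crev computable_pfst computable_psnd
        computable_add computable_app1[OF computable1_nontrivial] computable_cfold
        computable_nth computable_const; simp)
qed

text \<open>Each letter is replaced by the simple element \<open>F\<close> times it. The value 0 off
  range keeps the table finite; \<open>check\<close> rejects invalid letters separately.\<close>

definition letter_code :: "nat \<Rightarrow> nat" where
  "letter_code l = (if l < 2 * length gs then enc (F \<otimes> letter l) else 0)"

lemma dec_letter_code: "l < 2 * length gs \<Longrightarrow> dec (letter_code l) = F \<otimes> letter l"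
  by (simp add: letter_code_def F_letter_ival)

lemma computable1_letter_code: "computable1 letter_code"
  by (rule computable1_eventually_const[of "2 * length gs"]) (simp add: letter_code_def)

lemma val_letter_codes: "valid ls \<Longrightarrow> val (map letter_code ls) = F [^] length ls \<otimes> ev ls"
proof (induction ls)
  case (Cons l ls)
  then show ?case
    using F_pow_left_commute[of "letter l" "ev ls" "length ls"]
      F_central[of "F [^] length ls"]
    by (simp add: dec_letter_code m_assoc)
qed simp

definition word_divide :: "nat \<Rightarrow> nat \<Rightarrow> nat" where
  "word_divide k st = cfold divide st (cmap letter_code k)"

lemma computable2_word_divide: "computable2 word_divide"
  unfolding word_divide_def
  by (intro computable_cfold[OF computable2_divide] computable_cmap[OF computable1_letter_code]
      computable_nth; simp)

lemma rep_foldl_divide: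
  "\<lbrakk>rep st g; g \<in> carrier G\<rbrakk> \<Longrightarrow> rep (foldl divide st ts) (inv (val ts) \<otimes> g)"
proof (induction ts arbitrary: st g)
  case (Cons t ts)
  then show ?case
    using Cons.IH[OF rep_divide[OF Cons.prems, of t]] by (simp add: inv_mult_group m_assoc)
qed simp

lemma rep_word_divide_pow:
  assumes "rep st g" "g \<in> carrier G"
  shows "rep ((word_divide k ^^ n) st) (inv (val (map letter_code (list_decode k)) [^] n) \<otimes> g)"
proof (induction n)
  case (Suc n)
  then show ?case
    using rep_foldl_divide[OF Suc, of "map letter_code (list_decode k)"] assms(2)
    by (simp add: word_divide_def cfold_def inv_mult_group m_assoc flip: nat_pow_inv)
qed (use assms in simp)

section \<open>Testing a candidate root\<close>

definition init_state :: "nat \<Rightarrow> nat \<Rightarrow> nat \<Rightarrow> nat" where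
  "init_state k c n =
     prod_encode (0, (ccons (enc F) ^^ (n * csum (\<lambda>_. 1) k)) (cmap letter_code c))"

text \<open>For a candidate \<open>v\<close> and an input word \<open>w\<close> the initial word
  stands for \<open>F^(n |v|) F^|w| w\<close>. Dividing \<open>n\<close> times by
  \<open>F^|v| v\<close> and then by \<open>F^|w|\<close> removes all powers of \<open>F\<close> and
  leaves \<open>v^-n w\<close>.\<close>

definition final_state :: "nat \<Rightarrow> nat \<Rightarrow> nat \<Rightarrow> nat" where
  "final_state k c n =
     cfold divide ((word_divide k ^^ n) (init_state k c n)) (cmap (\<lambda>_. enc F) c)"

definition check :: "nat \<Rightarrow> nat \<Rightarrow> nat \<Rightarrow> nat" where
  "check k c n = csum (\<lambda>l. of_bool (l \<ge> 2 * length gs)) k +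
     pfst (final_state k c n) + csum nontrivial (psnd (final_state k c n))"

lemma computable3_check: "computable3 check"
proof -
  have 1: "computable1 (\<lambda>_. c)" for c
    by (rule computable_const)
  have 2: "computable1 (\<lambda>l. of_bool (l \<ge> 2 * length gs))"
    by (rule computable1_eventually_const[of "2 * length gs"]) simp
  have 3: "computable2 ccons"
    by (intro computable_ccons computable_nth; simp)
  have "computable3 init_state"
    unfolding init_state_def
    by (intro computable_prod_encode computable_funpow[OF 3] computable_mult
        computable_csum[OF 1] computable_cmap[OF computable1_letter_code]
        computable_nth computable_const; simp)
  then have "computable3 final_state"
    unfolding final_state_def
    by (intro computable_cfold[OF computable2_divide] computable_cmap[OF 1]
        computable_funpow[OF computable2_word_divide] computable_nth; simp)
  then show ?thesis
    unfolding check_def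
    by (intro computable_add computable_csum[OF 2] computable_csum[OF computable1_nontrivial]
        computable_pfst computable_psnd computable_nth; simp)
qed

lemma dec_enc_F [simp]: "dec (enc F) = F"
  using F_pow_ival[of 1 2] by simp

lemma val_map_F: "val (map (\<lambda>_. enc F) ts) = F [^] length ts"
  using val_replicate[of "length ts" "enc F"] by (simp add: map_replicate_const)

lemma check_eq_0_iff:
  assumes c: "valid (list_decode c)"
  shows "check k c n = 0 \<longleftrightarrow>
    valid (list_decode k) \<and> ev (list_decode k) [^] n = ev (list_decode c)"
proof -
  let ?v = "list_decode k" and ?w = "list_decode c"
  have "check k c n = 0 \<longleftrightarrow> valid ?v \<and> pfst (final_state k c n) = 0 \<and>
      val (list_decode (psnd (final_state k c n))) = \<one>"
    by (auto simp: check_def csum_eq valid_def val_eq_one_iff not_le)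
  moreover have "pfst (final_state k c n) = 0 \<and> val (list_decode (psnd (final_state k c n))) = \<one>
      \<longleftrightarrow> ev ?v [^] n = ev ?w" if v: "valid ?v"
  proof -
    let ?g = "F [^] (n * length ?v) \<otimes> (F [^] length ?w \<otimes> ev ?w)"
    let ?h = "inv (F [^] length ?w) \<otimes> (inv ((F [^] length ?v \<otimes> ev ?v) [^] n) \<otimes> ?g)"
    have "list_decode ((ccons t ^^ j) d) = replicate j t @ list_decode d" for t j d
      by (induction j) auto
    then have "rep (init_state k c n) ?g"
      using c
      by (simp add: rep_def init_state_def csum_eq val_append val_replicate val_letter_codes
          sum_list_triv)
    then have quot: "rep ((word_divide k ^^ n) (init_state k c n))
        (inv ((F [^] length ?v \<otimes> ev ?v) [^] n) \<otimes> ?g)"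
      using rep_word_divide_pow[of _ ?g n k] c v by (simp add: val_letter_codes)
    have "rep (final_state k c n) ?h"
      using rep_foldl_divide[OF quot, of "map (\<lambda>_. enc F) ?w"] c v
      by (simp add: final_state_def cfold_def val_map_F)
    \<comment> \<open>A positive failure count puts \<open>?h\<close> outside the cone, so it is not
      1.\<close>
    then have "pfst (final_state k c n) = 0 \<and> val (list_decode (psnd (final_state k c n))) = \<one>
        \<longleftrightarrow> ?h = \<one>"
      by (auto simp: rep_def split: if_splits)
    also have "?h = inv (ev ?v [^] n) \<otimes> ev ?w"
    proof -
      have "(F [^] length ?v \<otimes> ev ?v) [^] n = F [^] (n * length ?v) \<otimes> ev ?v [^] n"
        using v by (simp add: F_pow_mult_pow mult.commute)
      moreover have "inv (ev ?v [^] n) \<otimes> (F [^] length ?w \<otimes> ev ?w) =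
          F [^] length ?w \<otimes> (inv (ev ?v [^] n) \<otimes> ev ?w)"
        using c v by (intro F_pow_left_commute) auto
      ultimately show ?thesis
        using c v by (simp add: inv_mult_group m_assoc)
    qed
    also have "\<dots> = \<one> \<longleftrightarrow> ev ?v [^] n = ev ?w"
      by (metis c v ev_closed nat_pow_closed inv_mult_cancel(2) l_inv r_one)
    finally show ?thesis .
  qed
  ultimately show ?thesis by blast
qed

text \<open>Minimisation looks for the first code that passes the test or reaches the bound, so it
  always stops; testing that code once more tells the two outcomes apart. By
  \<open>short_root_ev\<close> a solvable equation has a solution below the bound.\<close>

theorem root_problem_solvable_gs: "root_problem_solvable G gs"
proof -
  obtain d where d: "ival 2 \<subseteq> short d"
    using ex_short_ival by blast
  \<comment> \<open>\<open>Suc\<close> makes the codes of words of admissible length strictly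
    smaller than the bound, so that the second factor in \<open>search\<close> is nonzero for
    them.\<close>
  define B where "B c n = Suc (code_bound (2 * length gs)
      (d * (c + 2 * card (ival 2) ^ (2 * (c * n) * n) + c * n)))" for c n
  define search where "search c n = (LEAST k. check k c n * (B c n - k) = 0)" for c n
  define result where
    "result c n = (if check (search c n) c n = 0 then Suc (search c n) else 0)" for c n
  have "computable2 search"
    unfolding search_def
  proof (rule computable2_mu)
    show "computable3 (\<lambda>k c n. check k c n * (B c n - k))"
      unfolding B_def
      by (intro computable_mult computable_app3[OF computable3_check] computable_diff computable_Suc
          computable_code_bound computable_add computable_power computable_nth computable_const; simp)
    show "\<exists>k. check k c n * (B c n - k) = 0" for c n
      by (intro exI[of _ "B c n"]) simp
  qed
  then have "computable2 result"
    unfolding result_def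
    by (intro computable_if_zero computable_Suc computable_app3[OF computable3_check]
        computable_nth computable_const; simp)
  then obtain p where p: "\<And>xs. length xs = 2 \<Longrightarrow> rec_eval p xs (result (xs ! 0) (xs ! 1))"
    unfolding computable_def by blast
  show ?thesis
    unfolding root_problem_solvable_def
  proof (intro exI[of _ p] allI impI)
    fix w and n :: nat
    assume "valid_word gs w \<and> n \<ge> 2"
    define c where "c = word_code w"
    have w: "letters (list_decode c) = w" and n: "n \<ge> 1"
      using \<open>valid_word gs w \<and> n \<ge> 2\<close> by (simp_all add: c_def)
    have c: "valid (list_decode c)"
      using \<open>valid_word gs w \<and> n \<ge> 2\<close> valid_word_letters[of gs "list_decode c"]
      by (simp add: w valid_def)
    have val_w: "word_val G gs w = ev (list_decode c)"
      using word_val_letters[of "list_decode c"] by (simp add: w)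
    have run: "rec_eval p [word_code w, n] (result c n)"
      using p[of "[c, n]"] by (simp add: c_def)
    show "if \<exists>x\<in>carrier G. x [^] n = word_val G gs w
        then \<exists>v. valid_word gs v \<and> word_val G gs v [^] n = word_val G gs w \<and>
               rec_eval p [word_code w, n] (Suc (word_code v))
        else rec_eval p [word_code w, n] 0"
    proof (cases "\<exists>x\<in>carrier G. x [^] n = word_val G gs w")
      case True
      then obtain ms where ms: "valid ms" "ev ms [^] n = ev (list_decode c)"
          "length ms \<le> d * (c + 2 * card (ival 2) ^ (2 * (c * n) * n) + c * n)"
        using short_root_ev[OF d c n _ _ length_list_decode_le] val_w by metis
      have ms_code: "check (list_encode ms) c n = 0"
        using ms c by (simp add: check_eq_0_iff)
      have ms_less: "list_encode ms < B c n"
        unfolding B_def less_Suc_eq_le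
        by (rule list_encode_le_code_bound) (use ms in \<open>auto simp: valid_def\<close>)
      have "search c n \<le> list_encode ms"
        unfolding search_def using ms_code by (intro Least_le) simp
      moreover have "check (search c n) c n * (B c n - search c n) = 0"
        unfolding search_def by (rule LeastI[of _ "list_encode ms"]) (simp add: ms_code)
      ultimately have *: "check (search c n) c n = 0"
        using ms_less by simp
      let ?v = "list_decode (search c n)"
      have "valid ?v" "ev ?v [^] n = ev (list_decode c)"
        using * c by (auto simp: check_eq_0_iff)
      then have "valid_word gs (letters ?v)" "word_val G gs (letters ?v) [^] n = word_val G gs w"
        by (simp_all add: valid_word_letters valid_def word_val_letters val_w)
      moreover have "rec_eval p [word_code w, n] (Suc (word_code (letters ?v)))"
        using run * by (simp add: result_def)
      ultimately show ?thesis
        using True by auto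
    next
      case False
      then have "check (search c n) c n \<noteq> 0"
        using c val_w by (auto simp: check_eq_0_iff)
      then show ?thesis
        using False run by (simp add: result_def)
    qed
  qed
qed

end

section \<open>The positive cone of a Garside group\<close>

text \<open>In a factorisation of an atom one factor is trivial, so the other is the atom. Hence
  every generating set contains all atoms, and a Garside monoid has finitely many.\<close>

lemma (in monoid) atom_mem_generators:
  assumes "a \<in> atoms G" "set xs \<subseteq> carrier G" "list_prod G xs = a"
  shows "a \<in> set xs"
  using assms
proof (induction xs)
  case Nil
  then show ?case by (simp add: atoms_def)
next
  case (Cons x xs)
  then have "x = \<one> \<or> list_prod G xs = \<one>"
    by (auto simp: atoms_def)
  then show ?case
    using Cons by auto
qed

text \<open>Atomic expressions of a divisor and of its complement concatenate to one of
  \<open>D\<close>, whose length is at most the norm of \<open>D\<close>. There are finitely many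
  words of bounded length in the finitely many atoms.\<close>

lemma finite_L_set:
  assumes M: "garside_monoid M" and D: "D \<in> carrier M"
  shows "finite (L_set M D)"
proof -
  have atomic: "atomic_monoid M"
    using M by (simp add: garside_monoid_def)
  interpret monoid M
    using atomic by (simp add: atomic_monoid_def)
  obtain S where S: "finite S" "monoid_generated_by M S"
    using M by (auto simp: garside_monoid_def)
  have "atoms M \<subseteq> S"
  proof
    fix a assume a: "a \<in> atoms M"
    then obtain xs where "set xs \<subseteq> S" "list_prod M xs = a"
      using S(2) by (auto simp: monoid_generated_by_def atoms_def)
    then show "a \<in> S"
      using atom_mem_generators[OF a, of xs] S(2) by (auto simp: monoid_generated_by_def)
  qed
  then have fin: "finite (atoms M)"
    using S(1) finite_subset by blast
  have "atom_norm M D < \<infinity>"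
    using atomic D by (simp add: atomic_monoid_def)
  then obtain N where N: "atom_norm M D = enat N"
    by auto
  have bound: "length xs \<le> N" if "set xs \<subseteq> atoms M" "list_prod M xs = D" for xs
  proof -
    have "enat (length xs) \<le> atom_norm M D"
      unfolding atom_norm_def by (rule SUP_upper) (use that in simp)
    then show ?thesis by (simp add: N)
  qed
  have gen: "\<exists>xs. set xs \<subseteq> atoms M \<and> list_prod M xs = a" if "a \<in> carrier M" for a
    using atomic that by (simp add: atomic_monoid_def monoid_generated_by_def)
  have at: "atoms M \<subseteq> carrier M"
    by (auto simp: atoms_def)
  have "L_set M D \<subseteq> list_prod M ` {xs. set xs \<subseteq> atoms M \<and> length xs \<le> N}"
  proof
    fix b assume "b \<in> L_set M D"
    then obtain c where c: "b \<in> carrier M" "c \<in> carrier M" "b \<otimes>\<^bsub>M\<^esub> c = D"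
      by (auto simp: L_set_def le_L_def)
    obtain xs ys where xy: "set xs \<subseteq> atoms M" "list_prod M xs = b"
        "set ys \<subseteq> atoms M" "list_prod M ys = c"
      using gen c by metis
    then have "list_prod M (xs @ ys) = D"
      using c at list_prod_append[of xs ys] by auto
    then have "length xs \<le> N"
      using bound[of "xs @ ys"] xy by simp
    then show "b \<in> list_prod M ` {xs. set xs \<subseteq> atoms M \<and> length xs \<le> N}"
      using xy by blast
  qed
  then show ?thesis
    using finite_lists_length_le[OF fin] finite_surj by blast
qed

lemma (in group) commute_inv:
  assumes "x \<otimes> z = z \<otimes> x" "x \<in> carrier G" "z \<in> carrier G"
  shows "inv x \<otimes> z = z \<otimes> inv x"
  by (metis assms inv_closed inv_mult_cancel(1) m_assoc m_closed r_inv r_one)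

text \<open>The powers of \<open>d\<close> act on the finite set \<open>S\<close> by conjugation.
  Two of them act alike, and \<open>d^e\<close>, with \<open>e\<close> the difference of the
  exponents, acts trivially.\<close>

lemma (in group) ex_pow_commute:
  assumes d: "d \<in> carrier G" and S: "finite S" "S \<subseteq> carrier G"
    and conj: "\<And>s. s \<in> S \<Longrightarrow> inv d \<otimes> s \<otimes> d \<in> S"
  shows "\<exists>e::nat. e > 0 \<and> (\<forall>s\<in>S. s \<otimes> d [^] e = d [^] e \<otimes> s)"
proof -
  obtain es where es: "set es = S"
    using finite_list[OF S(1)] by blast
  define f where "f i = map (\<lambda>s. inv (d [^] i) \<otimes> s \<otimes> d [^] i) es" for i :: nat
  have pow: "inv (d [^] i) \<otimes> s \<otimes> d [^] i \<in> S" if "s \<in> S" for s and i :: nat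
  proof (induction i)
    case (Suc i)
    have "inv (d [^] Suc i) \<otimes> s \<otimes> d [^] Suc i =
        inv d \<otimes> (inv (d [^] i) \<otimes> s \<otimes> d [^] i) \<otimes> d"
      using that S d by (auto simp: inv_mult_group m_assoc subset_iff)
    then show ?case
      using conj[OF Suc] by simp
  qed (use that S in auto)
  then have "range f \<subseteq> {xs. set xs \<subseteq> S \<and> length xs = length es}"
    by (auto simp: f_def es)
  then have "finite (range f)"
    using finite_lists_length_eq[OF S(1)] finite_subset by blast
  then have "\<not> inj f"
    using range_inj_infinite by blast
  then obtain i j where ij: "i < j" "f i = f j"
    by (metis injI linorder_neqE_nat)
  define e where "e = j - i"
  have "s \<otimes> d [^] e = d [^] e \<otimes> s" if "s \<in> S" for s
  proof -
    have s: "s \<in> carrier G" using that S by blast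
    have "d [^] j = d [^] e \<otimes> d [^] i"
      using ij d by (simp add: e_def nat_pow_mult)
    moreover have "inv (d [^] i) \<otimes> s \<otimes> d [^] i = inv (d [^] j) \<otimes> s \<otimes> d [^] j"
      using ij(2) that es by (auto simp: f_def)
    ultimately have "s \<otimes> d [^] i = inv (d [^] e) \<otimes> (s \<otimes> (d [^] e \<otimes> d [^] i))"
      using s d by (simp add: inv_mult_group m_assoc)
    then have "s \<otimes> d [^] i = (inv (d [^] e) \<otimes> s \<otimes> d [^] e) \<otimes> d [^] i"
      using s d by (simp add: m_assoc)
    then have "s = inv (d [^] e) \<otimes> s \<otimes> d [^] e"
      using s d by (metis inv_closed m_closed nat_pow_closed r_cancel)
    then show ?thesis
      using s d by (metis inv_closed inv_mult_cancel(2) m_assoc m_closed nat_pow_closed)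
  qed
  then show ?thesis
    using ij(1) by (intro exI[of _ e]) (simp add: e_def)
qed

section \<open>The cone and a central element in the group of fractions\<close>

locale garside_group =
  fixes M :: "('a, 'm) monoid_scheme" and G :: "('b, 'g) monoid_scheme" (structure)
    and \<iota> :: "'a \<Rightarrow> 'b"
  assumes garside: "garside_monoid M" and fractions: "group_of_fractions M G \<iota>"
begin

sublocale group G
  using fractions by (simp add: group_of_fractions_def)

sublocale M: monoid M
  using garside by (simp add: garside_monoid_def atomic_monoid_def)

lemma lattice_M: "Lattice.lattice \<lparr>carrier = carrier M, eq = (=), le = le_L M\<rparr>"
  using garside by (simp add: garside_monoid_def)

definition P :: "'b set" where
  "P = \<iota> ` carrier M"

lemma \<iota>_closed [simp]: "a \<in> carrier M \<Longrightarrow> \<iota> a \<in> carrier G"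
  and \<iota>_mult: "\<lbrakk>a \<in> carrier M; b \<in> carrier M\<rbrakk> \<Longrightarrow> \<iota> (a \<otimes>\<^bsub>M\<^esub> b) = \<iota> a \<otimes> \<iota> b"
  and \<iota>_inj: "\<lbrakk>\<iota> a = \<iota> b; a \<in> carrier M; b \<in> carrier M\<rbrakk> \<Longrightarrow> a = b"
  and ex_fraction: "g \<in> carrier G \<Longrightarrow> \<exists>a\<in>carrier M. \<exists>b\<in>carrier M. g = \<iota> a \<otimes> inv (\<iota> b)"
  using fractions
  by (auto simp: group_of_fractions_def mon_def hom_def dest: inj_onD)

lemma \<iota>_one [simp]: "\<iota> \<one>\<^bsub>M\<^esub> = \<one>"
  using \<iota>_mult[of "\<one>\<^bsub>M\<^esub>" "\<one>\<^bsub>M\<^esub>"] by (simp add: l_cancel_one')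

lemma P_carrier: "P \<subseteq> carrier G" and one_P: "\<one> \<in> P"
  using \<iota>_one M.one_closed by (auto simp: P_def simp del: \<iota>_one simp flip: \<iota>_one)

lemma mult_P: "\<lbrakk>a \<in> P; b \<in> P\<rbrakk> \<Longrightarrow> a \<otimes> b \<in> P"
  by (auto simp: P_def simp flip: \<iota>_mult)

lemma pow_P: "a \<in> P \<Longrightarrow> a [^] (n::nat) \<in> P"
  by (induction n) (auto simp: one_P mult_P)

text \<open>Injectivity of \<open>\<iota>\<close> brings an equation in the group back to the
  monoid, so the order given by the cone restricts to left divisibility.\<close>

lemma inv_\<iota>_mult_P_iff:
  assumes "a \<in> carrier M" "b \<in> carrier M"
  shows "inv (\<iota> a) \<otimes> \<iota> b \<in> P \<longleftrightarrow> le_L M a b"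
proof
  assume "inv (\<iota> a) \<otimes> \<iota> b \<in> P"
  then obtain c where c: "c \<in> carrier M" "inv (\<iota> a) \<otimes> \<iota> b = \<iota> c"
    by (auto simp: P_def)
  then have "\<iota> (a \<otimes>\<^bsub>M\<^esub> c) = \<iota> b"
    using assms by (simp add: \<iota>_mult flip: c(2))
  then show "le_L M a b"
    using c(1) assms \<iota>_inj[of "a \<otimes>\<^bsub>M\<^esub> c" b] by (auto simp: le_L_def)
next
  assume "le_L M a b"
  then obtain c where "c \<in> carrier M" "a \<otimes>\<^bsub>M\<^esub> c = b"
    by (auto simp: le_L_def)
  then show "inv (\<iota> a) \<otimes> \<iota> b \<in> P"
    using assms by (auto simp: \<iota>_mult P_def)
qed

lemma P_pointed:
  assumes "a \<in> P" "inv a \<in> P"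
  shows "a = \<one>"
proof -
  obtain x where x: "x \<in> carrier M" "a = \<iota> x"
    using assms by (auto simp: P_def)
  interpret L: Lattice.lattice "\<lparr>carrier = carrier M, eq = (=), le = le_L M\<rparr>"
    by (rule lattice_M)
  have "le_L M x \<one>\<^bsub>M\<^esub>" "le_L M \<one>\<^bsub>M\<^esub> x"
    using inv_\<iota>_mult_P_iff[of x "\<one>\<^bsub>M\<^esub>"] inv_\<iota>_mult_P_iff[of "\<one>\<^bsub>M\<^esub>" x] x assms by simp_all
  then show ?thesis
    using L.le_antisym[of x "\<one>\<^bsub>M\<^esub>"] x by simp
qed

lemma ex_join_P:
  assumes "a \<in> P" "b \<in> P"
  shows "\<exists>j\<in>P. inv a \<otimes> j \<in> P \<and> inv b \<otimes> j \<in> P \<and>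
          (\<forall>c\<in>P. inv a \<otimes> c \<in> P \<longrightarrow> inv b \<otimes> c \<in> P \<longrightarrow> inv j \<otimes> c \<in> P)"
proof -
  obtain x y where xy: "x \<in> carrier M" "a = \<iota> x" "y \<in> carrier M" "b = \<iota> y"
    using assms by (auto simp: P_def)
  interpret L: Lattice.lattice "\<lparr>carrier = carrier M, eq = (=), le = le_L M\<rparr>"
    by (rule lattice_M)
  obtain z where z: "least \<lparr>carrier = carrier M, eq = (=), le = le_L M\<rparr> z
      (Upper \<lparr>carrier = carrier M, eq = (=), le = le_L M\<rparr> {x, y})"
    using L.sup_of_two_exists[of x y] xy by auto
  then have zM: "z \<in> carrier M" "le_L M x z" "le_L M y z"
    "\<And>c. c \<in> carrier M \<Longrightarrow> le_L M x c \<Longrightarrow> le_L M y c \<Longrightarrow> le_L M z c"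
    using xy by (auto simp: least_def Upper_def)
  show ?thesis
  proof (intro bexI[of _ "\<iota> z"] conjI ballI impI)
    fix c assume c: "c \<in> P" "inv a \<otimes> c \<in> P" "inv b \<otimes> c \<in> P"
    then obtain w where w: "w \<in> carrier M" "c = \<iota> w"
      by (auto simp: P_def)
    then show "inv (\<iota> z) \<otimes> c \<in> P"
      using c zM xy by (simp add: inv_\<iota>_mult_P_iff)
  qed (use zM xy in \<open>simp_all add: inv_\<iota>_mult_P_iff\<close>, simp add: P_def)
qed

text \<open>The element is a power of the Garside element \<open>\<Delta>\<close>. Conjugation by
  \<open>\<Delta>\<close> maps its finite set of divisors to itself, so some power commutes with
  this generating set. Every positive element divides a power of it, which clears denominators in a
  fraction.\<close>

lemma ex_central:
  "\<exists>z\<in>P. (\<forall>x\<in>carrier G. x \<otimes> z = z \<otimes> x) \<and> (\<forall>g\<in>carrier G. \<exists>k::nat. z [^] k \<otimes> g \<in> P)"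
proof -
  obtain \<Delta> where \<Delta>: "\<Delta> \<in> carrier M" "L_set M \<Delta> = R_set M \<Delta>" "monoid_generated_by M (L_set M \<Delta>)"
    using garside by (auto simp: garside_monoid_def garside_element_def)
  define d where "d = \<iota> \<Delta>"
  define S where "S = \<iota> ` L_set M \<Delta>"
  have d: "d \<in> P" "d \<in> carrier G"
    using \<Delta>(1) by (auto simp: d_def P_def)
  have SP: "S \<subseteq> P"
    by (auto simp: S_def P_def L_set_def)
  \<comment> \<open>Here the equality of left and right divisors enters: the complement of a left
    divisor is a right divisor and thus in \<open>S\<close> again.\<close>
  have S_L: "\<exists>t\<in>S. s \<otimes> t = d" if s: "s \<in> S" for s
  proof -
    obtain a b where "a \<in> carrier M" "b \<in> carrier M" "a \<otimes>\<^bsub>M\<^esub> b = \<Delta>" "s = \<iota> a"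
      using s by (auto simp: S_def L_set_def le_L_def)
    moreover from this have "b \<in> L_set M \<Delta>"
      unfolding \<Delta>(2) by (auto simp: R_set_def le_R_def)
    ultimately show ?thesis
      by (auto simp: S_def d_def \<iota>_mult intro!: bexI[of _ b])
  qed
  \<comment> \<open>Taking complements twice, \<open>s t = d = t u\<close> gives
    \<open>s d = s t u = d u\<close>.\<close>
  have "inv d \<otimes> s \<otimes> d \<in> S" if s: "s \<in> S" for s
  proof -
    obtain t u where tu: "t \<in> S" "s \<otimes> t = d" "u \<in> S" "t \<otimes> u = d"
      using S_L s by metis
    have c: "s \<in> carrier G" "t \<in> carrier G" "u \<in> carrier G"
      using s tu SP P_carrier by auto
    have "s \<otimes> d = s \<otimes> (t \<otimes> u)"
      using tu by simp
    also have "\<dots> = d \<otimes> u"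
      using c tu(2) by (simp flip: m_assoc)
    finally have "inv d \<otimes> s \<otimes> d = u"
      using c d by (simp add: m_assoc)
    then show ?thesis
      using tu by simp
  qed
  moreover have "finite S" "S \<subseteq> carrier G"
    using finite_L_set[OF garside \<Delta>(1)] SP P_carrier by (auto simp: S_def)
  ultimately obtain e :: nat where e: "e > 0" "\<And>s. s \<in> S \<Longrightarrow> s \<otimes> d [^] e = d [^] e \<otimes> s"
    using ex_pow_commute[OF d(2)] by metis
  define z where "z = d [^] e"
  have z: "z \<in> P" "z \<in> carrier G"
    using d pow_P by (auto simp: z_def)
  have gen: "\<exists>ss. set ss \<subseteq> S \<and> list_prod G ss = p" if p: "p \<in> P" for p
  proof -
    obtain a where a: "a \<in> carrier M" "p = \<iota> a"
      using p by (auto simp: P_def)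
    then obtain xs where xs: "set xs \<subseteq> L_set M \<Delta>" "list_prod M xs = a"
      using \<Delta>(3) by (auto simp: monoid_generated_by_def)
    have "\<iota> (list_prod M xs) = list_prod G (map \<iota> xs)" if "set xs \<subseteq> carrier M" for xs
      using that by (induction xs) (auto simp: \<iota>_mult)
    moreover have "set xs \<subseteq> carrier M"
      using xs(1) by (auto simp: L_set_def)
    ultimately show ?thesis
      using xs a by (intro exI[of _ "map \<iota> xs"]) (auto simp: S_def)
  qed
  have prod: "list_prod G ss \<otimes> z = z \<otimes> list_prod G ss \<and>
      (\<exists>q\<in>P. \<exists>k::nat. list_prod G ss \<otimes> q = z [^] k)" if "set ss \<subseteq> S" for ss
    using that
  proof (induction ss)
    case Nil
    show ?case
      using z one_P by (auto intro!: bexI[of _ \<one>] exI[of _ 0])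
  next
    case (Cons s ss)
    then obtain q and k :: nat where q: "q \<in> P" "list_prod G ss \<otimes> q = z [^] k"
      and comm: "list_prod G ss \<otimes> z = z \<otimes> list_prod G ss"
      by auto
    have sc: "s \<in> carrier G" "set ss \<subseteq> carrier G" "q \<in> carrier G"
      using Cons.prems q SP P_carrier by auto
    have sz: "s \<otimes> z = z \<otimes> s"
      using e(2)[of s] Cons.prems by (simp add: z_def)
    obtain t where t: "t \<in> S" "s \<otimes> t = d"
      using S_L[of s] Cons.prems by auto
    have tc: "t \<in> P" "t \<in> carrier G"
      using t SP P_carrier by auto
    \<comment> \<open>Completes \<open>s\<close> to \<open>z = d^e\<close>: first to
      \<open>d\<close> by \<open>t\<close>, then by the remaining \<open>e - 1\<close>
      factors.\<close>
    let ?r = "t \<otimes> d [^] (e - 1)"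
    have "s \<otimes> ?r = d \<otimes> d [^] (e - 1)"
      using sc tc d t(2) by (simp flip: m_assoc)
    also have "\<dots> = z"
      using e(1) d nat_pow_Suc2[of d "e - 1"] by (simp add: z_def)
    finally have r: "s \<otimes> ?r = z" .
    have rc: "?r \<in> P" "?r \<in> carrier G"
      using tc d pow_P mult_P by auto
    have szk: "s \<otimes> z [^] k = z [^] k \<otimes> s"
      using sz sc(1) z(2) by (rule commute_nat_pow)
    have "list_prod G (s # ss) \<otimes> (q \<otimes> ?r) = s \<otimes> (list_prod G ss \<otimes> q) \<otimes> ?r"
      using sc rc by (simp add: m_assoc del: nat_pow_closed)
    also have "\<dots> = z [^] k \<otimes> (s \<otimes> ?r)"
      using sc rc q z szk by (simp add: m_assoc[symmetric])
    also have "\<dots> = z [^] Suc k"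
      using r by simp
    finally have "\<exists>q\<in>P. \<exists>k::nat. list_prod G (s # ss) \<otimes> q = z [^] k"
      using mult_P[OF q(1) rc(1)] by blast
    moreover have "list_prod G (s # ss) \<otimes> z = z \<otimes> list_prod G (s # ss)"
    proof -
      have "s \<otimes> list_prod G ss \<otimes> z = s \<otimes> z \<otimes> list_prod G ss"
        using sc z comm by (simp add: m_assoc)
      then show ?thesis
        using sc z sz by (simp add: m_assoc)
    qed
    ultimately show ?case by blast
  qed
  have comm_P: "p \<otimes> z = z \<otimes> p" and dvd_P: "\<exists>q\<in>P. \<exists>k::nat. p \<otimes> q = z [^] k" if "p \<in> P" for p
    using gen[OF that] prod by blast+
  have central: "x \<otimes> z = z \<otimes> x" if x: "x \<in> carrier G" for x
  proof -
    obtain a b where ab: "a \<in> P" "b \<in> P" "x = a \<otimes> inv b"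
      using ex_fraction[OF x] by (auto simp: P_def)
    have c: "a \<in> carrier G" "b \<in> carrier G"
      using ab P_carrier by auto
    have "a \<otimes> inv b \<otimes> z = a \<otimes> z \<otimes> inv b"
      using commute_inv[OF comm_P[OF ab(2)]] c z by (simp add: m_assoc)
    then show ?thesis
      using c z comm_P[OF ab(1)] by (simp add: ab(3) m_assoc)
  qed
  have "\<exists>k::nat. z [^] k \<otimes> x \<in> P" if x: "x \<in> carrier G" for x
  proof -
    obtain a b where ab: "a \<in> P" "b \<in> P" "x = a \<otimes> inv b"
      using ex_fraction[OF x] by (auto simp: P_def)
    obtain q and k :: nat where q: "q \<in> P" "b \<otimes> q = z [^] k"
      using dvd_P[OF ab(2)] by blast
    have c: "a \<in> carrier G" "b \<in> carrier G" "q \<in> carrier G"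
      using ab q P_carrier by auto
    have "x \<otimes> z [^] k = a \<otimes> q"
      using c by (simp add: ab(3) m_assoc flip: q(2))
    moreover have "x \<otimes> z [^] k = z [^] k \<otimes> x"
      using central[OF x] x z(2) by (rule commute_nat_pow)
    ultimately show ?thesis
      using mult_P[OF ab(1) q(1)] by metis
  qed
  then show ?thesis
    using z central by blast
qed

end

theorem corollary8p3:
  fixes M :: "('a, 'm) monoid_scheme"
    and G :: "('b, 'g) monoid_scheme"
    and \<iota> :: "'a \<Rightarrow> 'b"
    and gs :: "'b list"
  assumes "garside_monoid M"
    and "group_of_fractions M G \<iota>"
    and "set gs \<subseteq> carrier G"
    and "generate G (set gs) = carrier G"
  shows "root_problem_solvable G gs"
proof -
  interpret garside_group M G \<iota>
    using assms(1,2) by unfold_locales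
  obtain z where z: "z \<in> P" "\<And>x. x \<in> carrier G \<Longrightarrow> x \<otimes>\<^bsub>G\<^esub> z = z \<otimes>\<^bsub>G\<^esub> x"
      "\<And>g. g \<in> carrier G \<Longrightarrow> \<exists>k::nat. z [^]\<^bsub>G\<^esub> k \<otimes>\<^bsub>G\<^esub> g \<in> P"
    using ex_central by blast
  have zc: "z \<in> carrier G"
    using z(1) P_carrier by blast
  have shift_mono: "z [^]\<^bsub>G\<^esub> m \<otimes>\<^bsub>G\<^esub> g \<in> P"
    if "z [^]\<^bsub>G\<^esub> k \<otimes>\<^bsub>G\<^esub> g \<in> P" "k \<le> m" "g \<in> carrier G" for g and k m :: nat
    using mult_P[OF pow_P[OF z(1), of "m - k"] that(1)] that(2,3) zc
    by (simp add: nat_pow_mult flip: m_assoc)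
  define T where "T = set gs \<union> m_inv G ` set gs"
  have T: "finite T" "T \<subseteq> carrier G"
    using assms(3) by (auto simp: T_def)
  obtain f where f: "\<And>g. g \<in> carrier G \<Longrightarrow> z [^]\<^bsub>G\<^esub> (f g :: nat) \<otimes>\<^bsub>G\<^esub> g \<in> P"
    using z(3) by metis
  \<comment> \<open>\<open>N\<close> is at least \<open>f g\<close> for each of the finitely many
    \<open>g\<close> in \<open>T\<close>. Being positive, it also satisfies
    \<open>f g <= N * f g\<close>, so powers of \<open>F\<close> shift every element into the
    cone.\<close>
  define N where "N = Suc (sum f T)"
  define F where "F = z [^]\<^bsub>G\<^esub> N"
  have F: "F \<in> P" "F \<in> carrier G"
    using pow_P[OF z(1)] zc by (simp_all add: F_def)
  have F_T: "F \<otimes>\<^bsub>G\<^esub> g \<in> P" if "g \<in> T" for g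
  proof -
    have "f g \<le> N"
      using member_le_sum[of g T f] that T(1) by (simp add: N_def)
    then show ?thesis
      unfolding F_def using that T(2) by (intro shift_mono[OF f]) auto
  qed
  interpret cone_with_generators G P F gs
  proof unfold_locales
    show "x \<otimes>\<^bsub>G\<^esub> F = F \<otimes>\<^bsub>G\<^esub> x" if "x \<in> carrier G" for x
      unfolding F_def using z(2)[OF that] that zc by (rule commute_nat_pow)
    show "\<exists>k::nat. F [^]\<^bsub>G\<^esub> k \<otimes>\<^bsub>G\<^esub> g \<in> P" if "g \<in> carrier G" for g
    proof
      have "z [^]\<^bsub>G\<^esub> (N * f g) \<otimes>\<^bsub>G\<^esub> g \<in> P"
        using that by (intro shift_mono[OF f]) (auto simp: N_def)
      then show "F [^]\<^bsub>G\<^esub> f g \<otimes>\<^bsub>G\<^esub> g \<in> P"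
        using zc by (simp add: F_def nat_pow_pow)
    qed
    \<comment> \<open>As \<open>F^2\<close> comes from a monoid element \<open>D\<close>, the simple
      elements are images of left divisors of \<open>D\<close>.\<close>
    obtain D where D: "D \<in> carrier M" "F [^]\<^bsub>G\<^esub> (2::nat) = \<iota> D"
      using pow_P[OF F(1)] by (force simp: P_def)
    have "{s \<in> P. inv\<^bsub>G\<^esub> s \<otimes>\<^bsub>G\<^esub> F [^]\<^bsub>G\<^esub> (2::nat) \<in> P} \<subseteq> \<iota> ` L_set M D"
    proof
      fix s assume "s \<in> {s \<in> P. inv\<^bsub>G\<^esub> s \<otimes>\<^bsub>G\<^esub> F [^]\<^bsub>G\<^esub> (2::nat) \<in> P}"
      then obtain a where "a \<in> carrier M" "s = \<iota> a" "inv\<^bsub>G\<^esub> (\<iota> a) \<otimes>\<^bsub>G\<^esub> \<iota> D \<in> P"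
        by (auto simp: P_def D(2))
      then show "s \<in> \<iota> ` L_set M D"
        using D(1) by (simp add: inv_\<iota>_mult_P_iff L_set_def)
    qed
    then show "finite {s \<in> P. inv\<^bsub>G\<^esub> s \<otimes>\<^bsub>G\<^esub> F [^]\<^bsub>G\<^esub> (2::nat) \<in> P}"
      using finite_L_set[OF assms(1) D(1)] finite_surj by blast
  qed ((fact P_carrier one_P mult_P P_pointed ex_join_P F(1) assms(3) assms(4)
      | (rule F_T, simp add: T_def))+)
  show ?thesis
    by (rule root_problem_solvable_gs)
qed

end
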